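(* Let $\mathcal{C}$ be a class of infinite left-r.e. reals which contains a shift-persistent element. Then for any universal left-r.e. numbering $\alpha$, the following are equivalent: (i) $\{e:\alpha_e\in\mathcal{C}\}$ is a $\Sigma_3$ set; (ii) there exists a left-r.e. numbering of $\mathcal{C}$; (iii) there exists a left-r.e. Friedberg numbering of $\mathcal{C}$.
   Context: Reals are infinite binary sequences, identified with numbers in $[0,1]$. A real is left-r.e. if it is the limit of a recursive nondecreasing sequence of rationals. A real is infinite if its binary expansion has infinitely many 0's and infinitely many 1's. $X$ is a shift-persistent element of $\mathcal{C}$ if $\sigma^\frown X\in\mathcal{C}$ for every finite binary string $\sigma$. A left-r.e. numbering is a map $e\mapsto\alpha_e=\sum_{x\in\operatorname{dom}\varphi_e}2^{-|x|}$ (with $|x|=\lceil\log(x+1)\rceil$) for some partial recursive $\langle e,x\rangle\mapsto\varphi_e(x)$; it is a left-r.e. numbering of $\mathcal{C}$ if its range is exactly $\mathcal{C}$, universal if its range is all left-r.e. reals, and Friedberg if every member of its range has exactly one index. *)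

theory Defs
  imports "HOL-Analysis.Analysis" "HOL-Library.Omega_Words_Fun"
begin

section \<open>Partial recursive functions\<close>

text \<open>
  Kleene's \<open>\<mu>\<close>-recursive functions.  Terms carry no arity: the arity is the length of the argument
  list, and for each fixed length the terms denote exactly the usual partial recursive functions.
  The recursion variable of \<open>PrimRec\<close> and the search variable of \<open>Mu\<close> come first.
\<close>

datatype recf =
    Zero
  | Succ
  | Proj nat
  | Comp recf "recf list"
  | PrimRec recf recf
  | Mu recf

inductive evals :: "recf \<Rightarrow> nat list \<Rightarrow> nat \<Rightarrow> bool" where
  evals_Zero: "evals Zero xs 0"
| evals_Succ: "evals Succ (x # xs) (Suc x)"
| evals_Proj: "i < length xs \<Longrightarrow> evals (Proj i) xs (xs ! i)"
| evals_Comp: "list_all2 (\<lambda>g y. evals g xs y) gs ys \<Longrightarrow> evals f ys z \<Longrightarrow> evals (Comp f gs) xs z"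
| evals_PrimRec_0: "evals f xs y \<Longrightarrow> evals (PrimRec f g) (0 # xs) y"
| evals_PrimRec_Suc: "evals (PrimRec f g) (n # xs) r \<Longrightarrow> evals g (r # n # xs) y
    \<Longrightarrow> evals (PrimRec f g) (Suc n # xs) y"
| evals_Mu: "evals f (n # xs) 0 \<Longrightarrow> \<forall>m<n. \<exists>k. evals f (m # xs) (Suc k) \<Longrightarrow> evals (Mu f) xs n"

definition partial_recursive :: "nat \<Rightarrow> (nat list \<Rightarrow> nat option) \<Rightarrow> bool" where
  "partial_recursive n f \<longleftrightarrow>
     (\<exists>r. \<forall>xs. length xs = n \<longrightarrow> (\<forall>y. evals r xs y \<longleftrightarrow> f xs = Some y))"

definition recursive :: "nat \<Rightarrow> (nat list \<Rightarrow> nat) \<Rightarrow> bool" where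
  "recursive n f \<longleftrightarrow> partial_recursive n (\<lambda>xs. Some (f xs))"

definition recursive_pred :: "nat \<Rightarrow> (nat list \<Rightarrow> bool) \<Rightarrow> bool" where
  "recursive_pred n P \<longleftrightarrow> recursive n (\<lambda>xs. of_bool (P xs))"

definition Sigma3_set :: "nat set \<Rightarrow> bool" where
  "Sigma3_set A \<longleftrightarrow>
     (\<exists>R. recursive_pred 4 R \<and> A = {e. \<exists>a. \<forall>b. \<exists>c. R [e, a, b, c]})"

definition recursive_rat_seq :: "(nat \<Rightarrow> rat) \<Rightarrow> bool" where
  "recursive_rat_seq q \<longleftrightarrow>
     (\<exists>a b d. recursive 1 a \<and> recursive 1 b \<and> recursive 1 d \<and>
        (\<forall>s. q s = (of_nat (a [s]) - of_nat (b [s])) / of_nat (Suc (d [s]))))"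


section \<open>Reals as binary sequences\<close>

definition real_of_bits :: "bool word \<Rightarrow> real" where
  "real_of_bits b = (\<Sum>n. of_bool (b n) / 2 ^ Suc n)"

definition left_re :: "real \<Rightarrow> bool" where
  "left_re X \<longleftrightarrow> X \<in> {0..1} \<and>
     (\<exists>q. recursive_rat_seq q \<and> mono q \<and> (\<lambda>s. real_of_rat (q s)) \<longlonglongrightarrow> X)"

text \<open>Dyadic rationals have two binary expansions, but neither has infinitely many 0's and 1's.\<close>

definition infinite_real :: "real \<Rightarrow> bool" where
  "infinite_real X \<longleftrightarrow>
     (\<exists>b. X = real_of_bits b \<and> (\<exists>\<^sub>\<infinity>n. \<not> b n) \<and> (\<exists>\<^sub>\<infinity>n. b n))"

text \<open>
  The number denoted by \<open>\<sigma> \<frown> b\<close> depends on \<open>b\<close> only through the number denoted by \<open>b\<close>, so the choice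
  of the expansion \<open>b\<close> of \<open>X\<close> is immaterial.
\<close>

definition shift_persistent :: "real set \<Rightarrow> real \<Rightarrow> bool" where
  "shift_persistent C X \<longleftrightarrow> X \<in> C \<and>
     (\<exists>b. X = real_of_bits b \<and> (\<forall>\<sigma> :: bool list. real_of_bits (\<sigma> \<frown> b) \<in> C))"


section \<open>Left-r.e. numberings\<close>

definition len :: "nat \<Rightarrow> nat" where
  "len x = nat \<lceil>log 2 (real x + 1)\<rceil>"

text \<open>
  The weights \<open>2\<^bsup>-|x|\<^esup>\<close> are not summable over all of \<open>\<nat>\<close>; a numbering is a map into the reals of
  \<open>[0, 1]\<close>, so each of its sums has to converge to a number in that interval.
\<close>

definition left_re_numbering :: "(nat \<Rightarrow> real) \<Rightarrow> bool" where
  "left_re_numbering \<alpha> \<longleftrightarrow>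
     (\<exists>\<phi> :: nat \<Rightarrow> nat \<Rightarrow> nat option.
        partial_recursive 2 (\<lambda>xs. \<phi> (xs ! 0) (xs ! 1)) \<and>
        (\<forall>e. \<alpha> e \<in> {0..1} \<and> ((\<lambda>x. 1 / 2 ^ len x) has_sum \<alpha> e) (dom (\<phi> e))))"

definition left_re_numbering_of :: "(nat \<Rightarrow> real) \<Rightarrow> real set \<Rightarrow> bool" where
  "left_re_numbering_of \<alpha> C \<longleftrightarrow> left_re_numbering \<alpha> \<and> range \<alpha> = C"

definition universal_left_re_numbering :: "(nat \<Rightarrow> real) \<Rightarrow> bool" where
  "universal_left_re_numbering \<alpha> \<longleftrightarrow> left_re_numbering_of \<alpha> {X. left_re X}"

definition Friedberg :: "(nat \<Rightarrow> real) \<Rightarrow> bool" where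
  "Friedberg \<alpha> \<longleftrightarrow> (\<forall>X \<in> range \<alpha>. \<exists>!e. \<alpha> e = X)"

end

theory Submission
  imports Defs
begin

text \<open>
  A left-r.e. numbering amounts to a uniformly computable family of dyadic approximations from below
  \<open>K e s / 2 ^ s\<close>.  Hence \<open>\<alpha> e = \<beta> i\<close> is a \<open>\<Pi>\<^sub>2\<close> condition, so that a numbering \<open>\<beta>\<close> of \<open>C\<close> makes
  \<open>{e. \<exists>i. \<alpha> e = \<beta> i}\<close> a \<open>\<Sigma>\<^sub>3\<close> set.

  Conversely, if \<open>\<alpha> e \<in> C \<longleftrightarrow> (\<exists>a. \<forall>b. \<exists>c. R e a b c)\<close>, then for each \<open>(e, a)\<close> follow \<open>\<alpha> e\<close> as long as
  further instances of the \<open>\<Pi>\<^sub>2\<close> condition are verified, always keeping the current value of the form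
  \<open>\<sigma> \<frown> X\<close> with \<open>X\<close> shift-persistent.  If the verification stalls, a member \<open>\<sigma> \<frown> X\<close> of \<open>C\<close> results; an
  infinite real \<open>\<alpha> e\<close> is not dyadic, so otherwise nothing prevents the values from converging to it.

  For a Friedberg numbering, follow \<open>\<beta> e\<close> while it looks different from all \<open>\<beta> i\<close>, \<open>i < e\<close>, and all
  \<open>1\<^sup>n \<frown> X\<close>.  A follower that has to be given up can be turned into \<open>1\<^sup>n \<frown> X\<close> for any large \<open>n\<close>, because
  these reals tend to \<open>1\<close>.  Each \<open>n\<close> is used for at most one follower, which is decidable, and the
  unused \<open>1\<^sup>n \<frown> X\<close> get indices of their own.
\<close>

section \<open>Computable functions on encodable types\<close>

lemma evals_Proj_nth: "i < length xs \<Longrightarrow> xs ! i = y \<Longrightarrow> evals (Proj i) xs y"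
  using evals_Proj by blast

lemma evals_Comp1: "evals g xs y \<Longrightarrow> evals f [y] z \<Longrightarrow> evals (Comp f [g]) xs z"
  by (rule evals_Comp[where ys = "[y]"]) auto

lemma evals_Comp2:
  "evals g xs y \<Longrightarrow> evals h xs y' \<Longrightarrow> evals f [y, y'] z \<Longrightarrow> evals (Comp f [g, h]) xs z"
  by (rule evals_Comp[where ys = "[y, y']"]) auto

lemma evals_Comp3:
  "evals g xs y \<Longrightarrow> evals h xs y' \<Longrightarrow> evals k xs y'' \<Longrightarrow> evals f [y, y', y''] z
    \<Longrightarrow> evals (Comp f [g, h, k]) xs z"
  by (rule evals_Comp[where ys = "[y, y', y'']"]) auto

lemma evals_Comp4:
  "evals g xs y \<Longrightarrow> evals h xs y' \<Longrightarrow> evals k xs y'' \<Longrightarrow> evals l xs y''' \<Longrightarrow> evals f [y, y', y'', y'''] z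
    \<Longrightarrow> evals (Comp f [g, h, k, l]) xs z"
  by (rule evals_Comp[where ys = "[y, y', y'', y''']"]) auto

definition add_term :: recf where
  "add_term = PrimRec (Proj 0) (Comp Succ [Proj 0])"

lemma evals_add_term: "evals add_term [m, n] (m + n)"
  unfolding add_term_def
proof (induction m)
  case 0
  show ?case by (auto intro!: evals_PrimRec_0 evals_Proj_nth)
next
  case (Suc m)
  show ?case
    by (rule evals_PrimRec_Suc[OF Suc]) (auto intro!: evals_Comp1 evals_Proj_nth evals_Succ)
qed

definition pred_term :: recf where
  "pred_term = PrimRec Zero (Proj 1)"

lemma evals_pred_term: "evals pred_term [n] (n - 1)"
  unfolding pred_term_def
proof (induction n)
  case 0
  show ?case by (auto intro!: evals_PrimRec_0 evals_Zero)
next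
  case (Suc n)
  show ?case by (rule evals_PrimRec_Suc[OF Suc]) (simp add: evals_Proj_nth)
qed

text \<open>Recursion runs on the first argument, so the number to be subtracted comes
  first.\<close>

definition sub_term :: recf where
  "sub_term = PrimRec (Proj 0) (Comp pred_term [Proj 0])"

lemma evals_sub_term: "evals sub_term [n, m] (m - n)"
  unfolding sub_term_def
proof (induction n)
  case 0
  show ?case by (auto intro!: evals_PrimRec_0 evals_Proj_nth)
next
  case (Suc n)
  have "evals (Comp pred_term [Proj 0]) [m - n, n, m] (m - n - 1)"
    by (rule evals_Comp1[OF evals_Proj_nth evals_pred_term]) auto
  then show ?case
    by (intro evals_PrimRec_Suc[OF Suc]) simp
qed

definition triangle_term :: recf where
  "triangle_term = PrimRec Zero (Comp Succ [Comp add_term [Proj 0, Proj 1]])"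

lemma evals_triangle_term: "evals triangle_term [n] (triangle n)"
  unfolding triangle_term_def
proof (induction n)
  case 0
  show ?case by (auto intro!: evals_PrimRec_0 evals_Zero)
next
  case (Suc n)
  have "evals (Comp Succ [Comp add_term [Proj 0, Proj 1]]) [triangle n, n] (Suc (triangle n + n))"
    by (rule evals_Comp1[OF evals_Comp2[OF _ _ evals_add_term] evals_Succ])
      (auto intro: evals_Proj_nth)
  then show ?case
    by (intro evals_PrimRec_Suc[OF Suc]) simp
qed

definition pair_term :: recf where
  "pair_term = Comp add_term [Comp triangle_term [add_term], Proj 0]"

lemma evals_pair_term: "evals pair_term [m, n] (prod_encode (m, n))"
  unfolding pair_term_def prod_encode_def
  by (auto intro!: evals_Comp1 evals_Comp2 evals_Proj_nth evals_add_term evals_triangle_term)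

text \<open>Searches for the least k with z < \<open>triangle (Suc k)\<close>; for a pair code z
  this k is the sum of the two components. The truncated difference vanishes exactly when the bound
  is reached.\<close>

definition diagonal_term :: recf where
  "diagonal_term = Mu (Comp sub_term [Comp triangle_term [Comp Succ [Proj 0]], Comp Succ [Proj 1]])"

lemma triangle_mono: "m \<le> n \<Longrightarrow> triangle m \<le> triangle n"
  by (rule lift_Suc_mono_le[of triangle]) auto

lemma evals_diagonal_term: "evals diagonal_term [prod_encode (m, n)] (m + n)"
proof -
  let ?z = "prod_encode (m, n)"
  have step: "evals (Comp sub_term [Comp triangle_term [Comp Succ [Proj 0]], Comp Succ [Proj 1]])
      (k # [?z]) (Suc ?z - triangle (Suc k))" for k
    by (rule evals_Comp2[OF evals_Comp1[OF evals_Comp1[OF _ evals_Succ] evals_triangle_term]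
          evals_Comp1[OF _ evals_Succ] evals_sub_term])
      (auto intro: evals_Proj_nth)
  have "Suc ?z - triangle (Suc (m + n)) = 0"
    by (simp add: prod_encode_def)
  moreover have "\<exists>j. Suc ?z - triangle (Suc k) = Suc j" if "k < m + n" for k
  proof -
    have "triangle (Suc k) \<le> triangle (m + n)" using that by (intro triangle_mono) simp
    then have "triangle (Suc k) < Suc ?z" by (simp add: prod_encode_def)
    then show ?thesis by (metis Suc_diff_Suc)
  qed
  ultimately show ?thesis
    unfolding diagonal_term_def using step by (intro evals_Mu allI impI) metis+
qed

definition fst_term :: recf where
  "fst_term = Comp sub_term [Comp triangle_term [diagonal_term], Proj 0]"

lemma evals_fst_term: "evals fst_term [prod_encode (m, n)] m"
proof -
  have "evals sub_term [triangle (m + n), prod_encode (m, n)] m"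
    using evals_sub_term[of "triangle (m + n)" "prod_encode (m, n)"] by (simp add: prod_encode_def)
  then show ?thesis
    unfolding fst_term_def
    by (auto intro!: evals_Comp2 evals_Comp1 evals_diagonal_term evals_triangle_term evals_Proj_nth)
qed

definition snd_term :: recf where
  "snd_term = Comp sub_term [fst_term, diagonal_term]"

lemma evals_snd_term: "evals snd_term [prod_encode (m, n)] n"
  unfolding snd_term_def
  using evals_sub_term[of m "m + n"] by (auto intro!: evals_Comp2 evals_fst_term evals_diagonal_term)

text \<open>Recursion used as a zero test: the base case returns the third argument, while every
  step ignores the previous value and returns the second.\<close>

definition if_term :: recf where
  "if_term = PrimRec (Proj 1) (Proj 2)"

lemma evals_if_term: "evals if_term [n, x, y] (if n = 0 then y else x)"
  unfolding if_term_def
proof (induction n)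
  case 0
  show ?case by (auto intro!: evals_PrimRec_0 evals_Proj_nth)
next
  case (Suc n)
  show ?case by (rule evals_PrimRec_Suc[OF Suc]) (simp add: evals_Proj_nth)
qed

lemma evals_constant: "\<exists>r. \<forall>xs. evals r xs c"
proof (induction c)
  case 0
  show ?case using evals_Zero by blast
next
  case (Suc c)
  then obtain r where "\<And>xs. evals r xs c" by blast
  then have "\<And>xs. evals (Comp Succ [r]) xs (Suc c)"
    by (auto intro: evals_Comp1 evals_Succ)
  then show ?case by blast
qed

lemma evals_deterministic: "evals r xs y \<Longrightarrow> evals r xs z \<Longrightarrow> y = z"
proof (induction arbitrary: z rule: evals.induct)
  case (evals_Comp xs gs ys f y)
  from evals_Comp.prems obtain zs where zs: "list_all2 (\<lambda>g y. evals g xs y) gs zs" "evals f zs z"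
    by (auto elim: evals.cases)
  have "ys = zs"
    using evals_Comp.IH(1) zs(1)
  proof (induction gs arbitrary: ys zs)
    case (Cons g gs)
    then show ?case by (auto simp: list_all2_Cons1)
  qed auto
  with zs evals_Comp.IH(2) show ?case by blast
next
  case (evals_PrimRec_0 f xs y g)
  from evals_PrimRec_0.prems evals_PrimRec_0.IH show ?case by (auto elim: evals.cases)
next
  case (evals_PrimRec_Suc f g n xs r y)
  from evals_PrimRec_Suc.prems obtain r' where "evals (PrimRec f g) (n # xs) r'" "evals g (r' # n # xs) z"
    by (auto elim: evals.cases)
  with evals_PrimRec_Suc.IH show ?case by blast
next
  case (evals_Mu f n xs)
  from evals_Mu.prems obtain "evals f (z # xs) 0" "\<forall>m<z. \<exists>k. evals f (m # xs) (Suc k)"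
    by (auto elim: evals.cases)
  with evals_Mu.IH show ?case
    by (metis nat.distinct(1) nat_neq_iff)
qed (auto elim: evals.cases)

section \<open>Encodings and computability of total functions\<close>

class encodable =
  fixes encode :: "'a \<Rightarrow> nat"

instantiation nat :: encodable
begin
definition encode_nat :: "nat \<Rightarrow> nat" where [simp]: "encode_nat n = n"
instance ..
end

instantiation bool :: encodable
begin
definition encode_bool :: "bool \<Rightarrow> nat" where [simp]: "encode_bool b = of_bool b"
instance ..
end

instantiation prod :: (encodable, encodable) encodable
begin
definition encode_prod :: "'a \<times> 'b \<Rightarrow> nat" where
  "encode_prod p = prod_encode (encode (fst p), encode (snd p))"
instance ..
end

instantiation list :: (encodable) encodable
begin
primrec encode_list :: "'a list \<Rightarrow> nat" where
  "encode_list [] = 0"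
| "encode_list (x # xs) = Suc (prod_encode (encode x, encode_list xs))"
instance ..
end

lemma encode_Pair [simp]: "encode (x, y) = prod_encode (encode x, encode y)"
  by (simp add: encode_prod_def)

text \<open>One unary term on codes tracks the function; several arguments are passed as nested
  pairs, so that closure properties need no arities.\<close>

definition computable :: "('a::encodable \<Rightarrow> 'b::encodable) \<Rightarrow> bool" where
  "computable f \<longleftrightarrow> (\<exists>r. \<forall>x. evals r [encode x] (encode (f x)))"

lemma computableI: "(\<And>x. evals r [encode x] (encode (f x))) \<Longrightarrow> computable f"
  unfolding computable_def by blast

lemma computableE:
  assumes "computable f"
  obtains r where "\<And>x. evals r [encode x] (encode (f x))"
  using assms unfolding computable_def by blast

lemma computable_comp:
  assumes "computable f" "computable g"
  shows "computable (\<lambda>x. f (g x))"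
  using assms unfolding computable_def by (meson evals_Comp1)

text \<open>Only codes of values matter, so one term serves functions into different types: truth
  values and 0 or 1, numbers and the pairs they code.\<close>

lemma computable_cong_encode:
  assumes "computable f" "\<And>x. encode (f x) = encode (g x)"
  shows "computable g"
  using assms unfolding computable_def by simp

lemma computable_cong:
  assumes "computable f" "\<And>x. f x = g x"
  shows "computable g"
  using assms(1) by (rule computable_cong_encode) (simp add: assms(2))

named_theorems computable_intros

lemma computable_id [computable_intros]: "computable (\<lambda>x. x)"
  by (rule computableI[of "Proj 0"]) (auto intro: evals_Proj_nth)

lemma computable_const [computable_intros]: "computable (\<lambda>x. c)"
  using evals_constant[of "encode c"] by (auto intro: computableI)

lemma computable_Pair [computable_intros]:
  assumes "computable f" "computable g"
  shows "computable (\<lambda>x. (f x, g x))"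
proof -
  from assms obtain r r' where "\<And>x. evals r [encode x] (encode (f x))"
    "\<And>x. evals r' [encode x] (encode (g x))" by (meson computableE)
  then show ?thesis
    by (intro computableI[of "Comp pair_term [r, r']"]) (auto intro: evals_Comp2 evals_pair_term)
qed

lemma computable_fst [computable_intros]:
  assumes "computable f"
  shows "computable (\<lambda>x. fst (f x))"
  by (rule computable_comp[OF _ assms, of fst], rule computableI[of fst_term])
    (simp add: encode_prod_def evals_fst_term)

lemma computable_snd [computable_intros]:
  assumes "computable f"
  shows "computable (\<lambda>x. snd (f x))"
  by (rule computable_comp[OF _ assms, of snd], rule computableI[of snd_term])
    (simp add: encode_prod_def evals_snd_term)

lemma computable_comp2:
  assumes "computable (\<lambda>p. F (fst p) (snd p))" "computable f" "computable g"
  shows "computable (\<lambda>x. F (f x) (g x))"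
  using computable_comp[OF assms(1) computable_Pair[OF assms(2,3)]] by simp

lemma computable_comp3:
  assumes "computable (\<lambda>p. F (fst p) (fst (snd p)) (snd (snd p)))"
    "computable f" "computable g" "computable h"
  shows "computable (\<lambda>x. F (f x) (g x) (h x))"
  using computable_comp[OF assms(1) computable_Pair[OF assms(2) computable_Pair[OF assms(3,4)]]]
  by simp

lemma computable_of_evals2:
  fixes F :: "nat \<Rightarrow> nat \<Rightarrow> nat"
  assumes "\<And>m n. evals r [m, n] (F m n)" "computable f" "computable g"
  shows "computable (\<lambda>x. F (f x) (g x))"
proof (rule computable_comp2[OF _ assms(2,3)])
  show "computable (\<lambda>p. F (fst p) (snd p))"
    by (rule computableI[of "Comp r [fst_term, snd_term]"])
      (auto intro!: evals_Comp2[OF evals_fst_term evals_snd_term] simp: assms(1))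
qed

section \<open>Closure under arithmetic, conditionals, recursion and search\<close>

lemma computable_Suc [computable_intros]: "computable f \<Longrightarrow> computable (\<lambda>x. Suc (f x))"
  by (rule computable_comp[of Suc], rule computableI[of Succ]) (auto intro: evals_Succ)

lemma computable_add [computable_intros]:
  fixes f g :: "'a::encodable \<Rightarrow> nat"
  shows "computable f \<Longrightarrow> computable g \<Longrightarrow> computable (\<lambda>x. f x + g x)"
  by (rule computable_of_evals2[OF evals_add_term])

lemma computable_diff [computable_intros]:
  fixes f g :: "'a::encodable \<Rightarrow> nat"
  shows "computable f \<Longrightarrow> computable g \<Longrightarrow> computable (\<lambda>x. f x - g x)"
  by (rule computable_of_evals2[OF evals_sub_term, of g f])

lemma computable_if_0:
  fixes b :: "'a::encodable \<Rightarrow> nat"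
  assumes "computable b" "computable f" "computable g"
  shows "computable (\<lambda>x. if b x = 0 then g x else f x)"
proof -
  from assms obtain r s t where r: "\<And>x. evals r [encode x] (encode (b x))"
    "\<And>x. evals s [encode x] (encode (f x))" "\<And>x. evals t [encode x] (encode (g x))"
    by (meson computableE)
  show ?thesis
  proof (rule computableI[of "Comp if_term [r, s, t]"])
    fix x
    show "evals (Comp if_term [r, s, t]) [encode x] (encode (if b x = 0 then g x else f x))"
      using evals_Comp3[OF r evals_if_term] by (simp add: if_distrib)
  qed
qed

lemma computable_if [computable_intros]:
  assumes "computable P" "computable f" "computable g"
  shows "computable (\<lambda>x. if P x then f x else g x)"
proof -
  have "computable (\<lambda>x. of_bool (P x) :: nat)"
    using assms(1) by (rule computable_cong_encode) simp
  from computable_if_0[OF this assms(2,3)] show ?thesis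
    by (rule computable_cong) simp
qed

lemma computable_not [computable_intros]: "computable P \<Longrightarrow> computable (\<lambda>x. \<not> P x)"
  by (rule computable_cong[OF computable_if[of P "\<lambda>_. False" "\<lambda>_. True"]])
    (simp_all add: computable_const)

lemma computable_conj [computable_intros]:
  "computable P \<Longrightarrow> computable Q \<Longrightarrow> computable (\<lambda>x. P x \<and> Q x)"
  by (rule computable_cong[OF computable_if[of P Q "\<lambda>_. False"]]) (simp_all add: computable_const)

lemma computable_disj [computable_intros]:
  "computable P \<Longrightarrow> computable Q \<Longrightarrow> computable (\<lambda>x. P x \<or> Q x)"
  by (rule computable_cong[OF computable_if[of P "\<lambda>_. True" Q]]) (simp_all add: computable_const)

lemma computable_le [computable_intros]:
  fixes f g :: "'a::encodable \<Rightarrow> nat"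
  assumes "computable f" "computable g"
  shows "computable (\<lambda>x. f x \<le> g x)"
  by (rule computable_cong[OF
        computable_if_0[OF computable_diff[OF assms], of "\<lambda>_. False" "\<lambda>_. True"]])
    (simp_all add: computable_const)

lemma computable_less [computable_intros]:
  fixes f g :: "'a::encodable \<Rightarrow> nat"
  assumes "computable f" "computable g"
  shows "computable (\<lambda>x. f x < g x)"
  using computable_not[OF computable_le[OF assms(2,1)]] by (simp add: not_le)

lemma computable_eq [computable_intros]:
  fixes f g :: "'a::encodable \<Rightarrow> nat"
  assumes "computable f" "computable g"
  shows "computable (\<lambda>x. f x = g x)"
  using computable_conj[OF computable_le[OF assms] computable_le[OF assms(2,1)]]
  by (simp add: antisym_conv eq_iff)

lemma computable_rec_nat [computable_intros]:
  assumes "computable n" "computable a" "computable (\<lambda>p. f (fst p) (fst (snd p)) (snd (snd p)))"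
  shows "computable (\<lambda>x. rec_nat (a x) (\<lambda>k v. f k v x) (n x))"
proof -
  from assms obtain r s where r: "\<And>x. evals r [encode x] (encode (a x))"
    and s: "\<And>p. evals s [encode p] (encode (f (fst p) (fst (snd p)) (snd (snd p))))"
    by (meson computableE)
  \<comment> \<open>\<open>PrimRec\<close> supplies the previous value before the counter, whereas
    \<open>f\<close> takes the counter first; hence \<open>Proj 1\<close> precedes
    \<open>Proj 0\<close>.\<close>
  let ?s = "Comp s [Comp pair_term [Proj 1, Comp pair_term [Proj 0, Proj 2]]]"
  have s': "evals ?s [encode v, k, encode x] (encode (f k v x))" for v k x
    using s[of "(k, v, x)"]
    by (auto intro!: evals_Comp1 evals_Comp2 evals_pair_term evals_Proj_nth)
  have rec: "evals (PrimRec r ?s) [k, encode x] (encode (rec_nat (a x) (\<lambda>k v. f k v x) k))" for k x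
  proof (induction k)
    case 0
    show ?case by (auto intro: evals_PrimRec_0 r)
  next
    case (Suc k)
    show ?case by (rule evals_PrimRec_Suc[OF Suc]) (use s' in simp)
  qed
  have "computable (\<lambda>p. rec_nat (a (snd p)) (\<lambda>k v. f k v (snd p)) (fst p))"
    by (rule computableI[of "Comp (PrimRec r ?s) [fst_term, snd_term]"])
      (use evals_Comp2[OF evals_fst_term evals_snd_term rec] in \<open>simp add: encode_prod_def\<close>)
  from computable_comp[OF this computable_Pair[OF assms(1) computable_id]]
  show ?thesis by simp
qed

lemma computable_LEAST [computable_intros]:
  fixes P :: "nat \<Rightarrow> 'a::encodable \<Rightarrow> bool"
  assumes "computable (\<lambda>p. P (fst p) (snd p))" "\<And>x. \<exists>n. P n x"
  shows "computable (\<lambda>x. LEAST n. P n x)"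
proof -
  \<comment> \<open>\<open>Mu\<close> looks for the value 0, so truth is coded by 0 here.\<close>
  have "computable (\<lambda>p. if P (fst p) (snd p) then 0 else (1::nat))"
    by (intro computable_intros assms(1))
  then obtain r where r: "\<And>p. evals r [encode p] (if P (fst p) (snd p) then 0 else 1)"
    unfolding computable_def encode_nat_def by blast
  have r': "evals (Comp r [pair_term]) [n, encode x] (if P n x then 0 else Suc 0)" for n x
    using r[of "(n, x)"] by (auto intro: evals_Comp1 evals_pair_term)
  show ?thesis
  proof (rule computableI[of "Mu (Comp r [pair_term])"])
    fix x
    let ?n = "LEAST n. P n x"
    have "P ?n x" using assms(2) by (rule LeastI_ex)
    then have 1: "evals (Comp r [pair_term]) [?n, encode x] 0" using r'[of ?n x] by simp
    have 2: "\<exists>k. evals (Comp r [pair_term]) [m, encode x] (Suc k)" if "m < ?n" for m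
      using not_less_Least[OF that] r'[of m x] by auto
    show "evals (Mu (Comp r [pair_term])) [encode x] (encode ?n)"
      unfolding encode_nat_def using 1 2 by (intro evals_Mu allI impI) blast+
  qed
qed

lemma computable_all_less [computable_intros]:
  fixes b :: "'a::encodable \<Rightarrow> nat"
  assumes "computable b" "computable (\<lambda>p. P (fst p) (snd p))"
  shows "computable (\<lambda>x. \<forall>i<b x. P i x)"
proof -
  have "computable (\<lambda>x. rec_nat True (\<lambda>k v. v \<and> P k x) (b x))"
    by (intro computable_intros assms computable_comp2[OF assms(2)])
  moreover have "rec_nat True (\<lambda>k v. v \<and> P k x) n = (\<forall>i<n. P i x)" for n x
    by (induction n) (auto simp: less_Suc_eq)
  ultimately show ?thesis by simp
qed

lemma computable_ex_less [computable_intros]: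
  fixes b :: "'a::encodable \<Rightarrow> nat"
  assumes "computable b" "computable (\<lambda>p. P (fst p) (snd p))"
  shows "computable (\<lambda>x. \<exists>i<b x. P i x)"
  using computable_not[OF computable_all_less[OF assms(1) computable_not[OF assms(2)]]] by simp

lemma computable_sum [computable_intros]:
  fixes f :: "nat \<Rightarrow> 'a::encodable \<Rightarrow> nat"
  assumes "computable b" "computable (\<lambda>p. f (fst p) (snd p))"
  shows "computable (\<lambda>x. \<Sum>i<b x. f i x)"
proof -
  have "computable (\<lambda>x. rec_nat 0 (\<lambda>k v. v + f k x) (b x))"
    by (intro computable_intros assms computable_comp2[OF assms(2)])
  moreover have "rec_nat 0 (\<lambda>k v. v + f k x) n = (\<Sum>i<n. f i x)" for n x
    by (induction n) auto
  ultimately show ?thesis by simp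
qed

lemma computable_mult [computable_intros]:
  fixes f g :: "'a::encodable \<Rightarrow> nat"
  assumes "computable f" "computable g"
  shows "computable (\<lambda>x. f x * g x)"
proof -
  have "computable (\<lambda>x. \<Sum>i<f x. g x)"
    by (intro computable_intros assms computable_comp[OF assms(2)])
  then show ?thesis by simp
qed

lemma computable_power [computable_intros]:
  fixes f g :: "'a::encodable \<Rightarrow> nat"
  assumes "computable f" "computable g"
  shows "computable (\<lambda>x. f x ^ g x)"
proof -
  have "computable (\<lambda>x. rec_nat 1 (\<lambda>k v. f x * v) (g x))"
    by (intro computable_intros assms computable_comp[OF assms(1)])
  moreover have "rec_nat 1 (\<lambda>k v. a * v) n = a ^ n" for a n :: nat
    by (induction n) auto
  ultimately show ?thesis by simp
qed

lemma computable_prod_decode [computable_intros]: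
  "computable f \<Longrightarrow> computable (\<lambda>x. prod_decode (f x))"
  by (rule computable_cong_encode[of f]) (simp_all add: encode_prod_def)

lemma computable_prod_encode [computable_intros]:
  "computable f \<Longrightarrow> computable (\<lambda>x. prod_encode (f x))"
  by (rule computable_cong_encode[of f]) (simp_all add: encode_prod_def)

lemma computable_Cons [computable_intros]:
  assumes "computable f" "computable g"
  shows "computable (\<lambda>x. f x # g x)"
proof -
  have "computable (\<lambda>x. Suc (prod_encode (encode (f x), encode (g x))))"
  proof (rule computable_Suc, rule computable_cong_encode)
    show "computable (\<lambda>x. (f x, g x))" using assms by (rule computable_Pair)
  qed simp
  then show ?thesis by (rule computable_cong_encode) simp
qed

lemma computable_case_list [computable_intros]:
  fixes f :: "'a::encodable \<Rightarrow> nat list"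
  assumes "computable f" "computable d" "computable (\<lambda>p. g (fst p) (fst (snd p)) (snd (snd p)))"
  shows "computable (\<lambda>x. case f x of [] \<Rightarrow> d x | y # ys \<Rightarrow> g y ys x)"
proof -
  define c where "c x = encode (f x)" for x
  \<comment> \<open>For the empty list the code minus 1 truncates to 0, the pair code of (0, 0); the
    default \<open>(0, [])\<close> has just this code.\<close>
  define h where "h x = (case f x of [] \<Rightarrow> (0, []) | y # ys \<Rightarrow> (y, ys))" for x
  have c: "computable c"
    using assms(1) unfolding c_def by (rule computable_cong_encode) simp
  have "computable (\<lambda>x. prod_decode (c x - 1))"
    by (intro computable_intros c)
  moreover have "prod_encode (0, 0) = 0" by (simp add: prod_encode_def)
  ultimately have h: "computable h"
    by (elim computable_cong_encode) (auto simp: h_def c_def encode_prod_def split: list.split)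
  have "computable (\<lambda>x. if c x = 0 then d x else g (fst (h x)) (snd (h x)) x)"
    by (intro computable_if_0 c assms(2) computable_comp3[OF assms(3)] computable_intros h)
  then show ?thesis
    by (rule computable_cong) (auto simp: c_def h_def split: list.split)
qed

section \<open>Bounded evaluation\<close>

text \<open>Evaluation in which every unbounded search stops at the bound \<open>s\<close>; the result is \<open>0\<close> if this
  cuts off the computation (or it is undefined), and \<open>Suc y\<close> if the value is \<open>y\<close>.\<close>

primrec bounded_eval :: "recf \<Rightarrow> nat \<Rightarrow> nat list \<Rightarrow> nat" where
  "bounded_eval Zero s xs = 1"
| "bounded_eval Succ s xs = (case xs of [] \<Rightarrow> 0 | x # _ \<Rightarrow> Suc (Suc x))"
| "bounded_eval (Proj i) s xs = (case drop i xs of [] \<Rightarrow> 0 | x # _ \<Rightarrow> Suc x)"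
| "bounded_eval (Comp f gs) s xs =
    (if 0 \<in> set (map (\<lambda>g. bounded_eval g s xs) gs) then 0
     else bounded_eval f s (map (\<lambda>y. y - 1) (map (\<lambda>g. bounded_eval g s xs) gs)))"
| "bounded_eval (PrimRec f g) s xs =
    (case xs of [] \<Rightarrow> 0 | n # ys \<Rightarrow>
       rec_nat (bounded_eval f s ys)
         (\<lambda>k v. if v = 0 then 0 else bounded_eval g s ((v - 1) # k # ys)) n)"
| "bounded_eval (Mu f) s xs =
    (let n = LEAST n. s \<le> n \<or> bounded_eval f s (n # xs) \<le> 1
     in if n < s \<and> bounded_eval f s (n # xs) = 1 then Suc n else 0)"

lemma computable_drop [computable_intros]:
  fixes f :: "'a::encodable \<Rightarrow> nat list"
  assumes "computable f"
  shows "computable (\<lambda>x. drop i (f x))"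
proof (induction i)
  case 0
  then show ?case using assms by simp
next
  case (Suc i)
  have "computable (\<lambda>x. case drop i (f x) of [] \<Rightarrow> [] | y # ys \<Rightarrow> ys)"
    by (intro computable_intros Suc)
  then show ?case
    by (rule computable_cong) (simp add: drop_Suc drop_tl split: list.split)
qed

text \<open>The term \<open>r\<close> is fixed and only the bound and the arguments vary, so
  structural induction suffices in place of a universal function.\<close>

lemma computable_bounded_eval: "computable (\<lambda>p. bounded_eval r (fst p) (snd p))"
proof (induction r)
  case Zero
  show ?case by (simp add: computable_const)
next
  case Succ
  show ?case unfolding bounded_eval.simps by (intro computable_intros)
next
  case (Proj i)
  show ?case unfolding bounded_eval.simps by (intro computable_intros)
next
  case (Comp f gs)
  have zero: "computable (\<lambda>p. 0 \<in> set (map (\<lambda>g. bounded_eval g (fst p) (snd p)) gs))"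
    using Comp.IH(2)
  proof (induction gs)
    case (Cons g gs)
    have "computable (\<lambda>p. 0 = bounded_eval g (fst p) (snd p) \<or>
        0 \<in> set (map (\<lambda>g. bounded_eval g (fst p) (snd p)) gs))"
      by (intro computable_disj computable_eq computable_const Cons) (use Cons.prems in auto)
    then show ?case by simp
  qed (simp add: computable_const)
  have args: "computable (\<lambda>p. map (\<lambda>y. y - 1) (map (\<lambda>g. bounded_eval g (fst p) (snd p)) gs))"
    using Comp.IH(2)
  proof (induction gs)
    case (Cons g gs)
    have "computable (\<lambda>p. (bounded_eval g (fst p) (snd p) - 1) #
        map (\<lambda>y. y - 1) (map (\<lambda>g. bounded_eval g (fst p) (snd p)) gs))"
      by (intro computable_Cons computable_diff computable_const Cons) (use Cons.prems in auto)
    then show ?case by simp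
  qed (simp add: computable_const)
  show ?case
    unfolding bounded_eval.simps
    by (intro computable_if zero computable_comp2[OF Comp.IH(1)] args computable_intros)
next
  case (PrimRec f g)
  show ?case
    unfolding bounded_eval.simps
    by (intro computable_intros computable_comp2[OF PrimRec.IH(1)] computable_comp2[OF PrimRec.IH(2)])
next
  case (Mu f)
  show ?case
    unfolding bounded_eval.simps Let_def
    by (intro computable_intros computable_comp2[OF Mu.IH]) auto
qed

lemma Suc_Suc_exI: "\<not> n \<le> Suc 0 \<Longrightarrow> \<exists>k. n = Suc (Suc k)"
  by presburger

lemma evals_of_bounded_eval: "bounded_eval r s xs = Suc y \<Longrightarrow> evals r xs y"
proof (induction r arbitrary: xs y)
  case Zero
  then show ?case by (auto intro: evals_Zero)
next
  case Succ
  then show ?case by (auto intro: evals_Succ split: list.splits)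
next
  case (Proj i)
  then show ?case
    by (cases "i < length xs")
      (auto simp: Cons_nth_drop_Suc[symmetric] intro: evals_Proj)
next
  case (Comp f gs)
  let ?ys = "map (\<lambda>g. bounded_eval g s xs) gs"
  from Comp.prems have nz: "0 \<notin> set ?ys" and f: "bounded_eval f s (map (\<lambda>y. y - 1) ?ys) = Suc y"
    by (auto split: if_splits)
  have "list_all2 (\<lambda>g y. evals g xs y) gs (map (\<lambda>y. y - 1) ?ys)"
  proof (unfold list_all2_conv_all_nth, intro conjI allI impI)
    fix i assume i: "i < length gs"
    with nz have "bounded_eval (gs ! i) s xs \<noteq> 0" using nth_mem[OF i] by (force simp: image_iff)
    with i show "evals (gs ! i) xs (map (\<lambda>y. y - 1) ?ys ! i)"
      using Comp.IH(2)[OF nth_mem[OF i]] by simp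
  qed simp
  then show ?case using Comp.IH(1)[OF f] by (rule evals_Comp)
next
  case (PrimRec f g)
  then obtain n ys where xs: "xs = n # ys" by (cases xs) auto
  have "rec_nat (bounded_eval f s ys) (\<lambda>k v. if v = 0 then 0 else bounded_eval g s ((v - 1) # k # ys)) n
    = Suc y \<Longrightarrow> evals (PrimRec f g) (n # ys) y" for n y
  proof (induction n arbitrary: y)
    case 0
    then show ?case using PrimRec.IH(1) by (auto intro: evals_PrimRec_0)
  next
    case (Suc n)
    let ?v = "rec_nat (bounded_eval f s ys)
      (\<lambda>k v. if v = 0 then 0 else bounded_eval g s ((v - 1) # k # ys)) n"
    from Suc.prems obtain z where z: "?v = Suc z" "bounded_eval g s (z # n # ys) = Suc y"
      by (cases ?v) auto
    show ?case by (rule evals_PrimRec_Suc[OF Suc.IH[OF z(1)] PrimRec.IH(2)[OF z(2)]])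
  qed
  then show ?case using PrimRec.prems xs by simp
next
  case (Mu f)
  define n where "n = (LEAST n. s \<le> n \<or> bounded_eval f s (n # xs) \<le> 1)"
  have "y = n" "n < s" "bounded_eval f s (n # xs) = 1"
    using Mu.prems by (auto simp: n_def Let_def split: if_splits)
  \<comment> \<open>Results 0 and 1 stand for a cut-off and for the value 0. Before the least n
    neither occurs, so all earlier values are positive, as \<open>evals_Mu\<close> demands.\<close>
  moreover have "\<exists>k. bounded_eval f s (m # xs) = Suc (Suc k)" if "m < n" for m
    using not_less_Least[OF that[unfolded n_def]]
    by (auto intro!: Suc_Suc_exI)
  ultimately show ?case
    using Mu.IH by (auto intro!: evals_Mu) blast
qed

text \<open>A successful evaluation rests on successful subevaluations only, and these persist. In
  the \<open>Mu\<close> case the positive values before n persist too, so the larger bound does not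
  move the place where the search stops.\<close>

lemma bounded_eval_mono:
  assumes "s \<le> t"
  shows "bounded_eval r s xs = Suc y \<Longrightarrow> bounded_eval r t xs = Suc y"
proof (induction r arbitrary: xs y)
  case (Comp f gs)
  have "bounded_eval g t xs = bounded_eval g s xs" if "g \<in> set gs" for g
    using that Comp.prems Comp.IH(2)[OF that, of xs "bounded_eval g s xs - 1"]
    by (auto split: if_splits simp: image_iff)
  then have eq: "map (\<lambda>g. bounded_eval g t xs) gs = map (\<lambda>g. bounded_eval g s xs) gs" by simp
  from Comp.prems show ?case
    unfolding bounded_eval.simps eq using Comp.IH(1) by (auto split: if_splits simp del: map_map)
next
  case (PrimRec f g)
  then obtain n ys where xs: "xs = n # ys" by (cases xs) auto
  let ?v = "\<lambda>s n. rec_nat (bounded_eval f s ys)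
    (\<lambda>k v. if v = 0 then 0 else bounded_eval g s ((v - 1) # k # ys)) n"
  have "?v s n = Suc y \<Longrightarrow> ?v t n = Suc y" for n y
  proof (induction n arbitrary: y)
    case 0
    then show ?case using PrimRec.IH(1) by simp
  next
    case (Suc n)
    from Suc.prems obtain z where z: "?v s n = Suc z" "bounded_eval g s (z # n # ys) = Suc y"
      by (cases "?v s n") auto
    then show ?case using Suc.IH[OF z(1)] PrimRec.IH(2) by simp
  qed
  then show ?case using PrimRec.prems xs by simp
next
  case (Mu f)
  define n where "n = (LEAST n. s \<le> n \<or> bounded_eval f s (n # xs) \<le> 1)"
  have n: "y = n" "n < s" "bounded_eval f s (n # xs) = 1"
    using Mu.prems by (auto simp: n_def Let_def split: if_splits)
  have "\<exists>k. bounded_eval f s (m # xs) = Suc (Suc k)" if "m < n" for m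
    using not_less_Least[OF that[unfolded n_def]]
    by (auto intro!: Suc_Suc_exI)
  then have less: "\<exists>k. bounded_eval f t (m # xs) = Suc (Suc k)" if "m < n" for m
    using Mu.IH that by meson
  have n': "bounded_eval f t (n # xs) = 1"
    using Mu.IH n(3) by simp
  have "(LEAST n. t \<le> n \<or> bounded_eval f t (n # xs) \<le> 1) = n"
  proof (rule Least_equality)
    fix m assume m: "t \<le> m \<or> bounded_eval f t (m # xs) \<le> 1"
    show "n \<le> m"
    proof (rule ccontr)
      assume "\<not> n \<le> m"
      with less[of m] m n(2) assms show False by auto
    qed
  qed (simp add: n')
  then show ?case using n n' assms by (simp add: Let_def)
qed auto

text \<open>Each rule has finitely many evaluations as premises; by monotonicity the maximum of
  their bounds serves them all.\<close>

lemma bounded_eval_of_evals: "evals r xs y \<Longrightarrow> \<exists>s. bounded_eval r s xs = Suc y"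
proof (induction rule: evals.induct)
  case (evals_Proj i xs)
  then show ?case by (auto simp: Cons_nth_drop_Suc[symmetric])
next
  case (evals_Comp xs gs ys f z)
  from evals_Comp.IH(1) have "\<exists>s. map (\<lambda>g. bounded_eval g s xs) gs = map Suc ys"
  proof (induction rule: list_all2_induct)
    case (Cons g gs y ys)
    then obtain s t where s: "bounded_eval g s xs = Suc y" "map (\<lambda>g. bounded_eval g t xs) gs = map Suc ys"
      by blast
    have "bounded_eval g (max s t) xs = Suc y"
      using s(1) by (rule bounded_eval_mono[rotated]) simp
    moreover have "map (\<lambda>g. bounded_eval g (max s t) xs) gs = map Suc ys"
    proof (rule nth_equalityI)
      show "length (map (\<lambda>g. bounded_eval g (max s t) xs) gs) = length (map Suc ys)"
        using map_eq_imp_length_eq[OF s(2)] by simp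
      fix i assume i: "i < length (map (\<lambda>g. bounded_eval g (max s t) xs) gs)"
      then have "bounded_eval (gs ! i) t xs = Suc (ys ! i)"
        using arg_cong[OF s(2), of "\<lambda>ys. ys ! i"] map_eq_imp_length_eq[OF s(2)] by simp
      then have "bounded_eval (gs ! i) (max s t) xs = Suc (ys ! i)"
        by (rule bounded_eval_mono[rotated]) simp
      then show "map (\<lambda>g. bounded_eval g (max s t) xs) gs ! i = map Suc ys ! i"
        using i map_eq_imp_length_eq[OF s(2)] by simp
    qed
    ultimately show ?case by (intro exI[of _ "max s t"]) simp
  qed simp
  then obtain s where s: "map (\<lambda>g. bounded_eval g s xs) gs = map Suc ys" by blast
  obtain t where t: "bounded_eval f t ys = Suc z" using evals_Comp.IH(2) by blast
  have "map (\<lambda>g. bounded_eval g (max s t) xs) gs = map Suc ys"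
  proof (rule nth_equalityI)
    show "length (map (\<lambda>g. bounded_eval g (max s t) xs) gs) = length (map Suc ys)"
      using map_eq_imp_length_eq[OF s] by simp
    fix i assume i: "i < length (map (\<lambda>g. bounded_eval g (max s t) xs) gs)"
    then have "bounded_eval (gs ! i) s xs = Suc (ys ! i)"
      using arg_cong[OF s, of "\<lambda>ys. ys ! i"] map_eq_imp_length_eq[OF s] by simp
    then have "bounded_eval (gs ! i) (max s t) xs = Suc (ys ! i)"
      by (rule bounded_eval_mono[rotated]) simp
    then show "map (\<lambda>g. bounded_eval g (max s t) xs) gs ! i = map Suc ys ! i"
      using i map_eq_imp_length_eq[OF s] by simp
  qed
  moreover have "bounded_eval f (max s t) ys = Suc z"
    using t by (rule bounded_eval_mono[rotated]) simp
  ultimately show ?case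
    unfolding bounded_eval.simps by (intro exI[of _ "max s t"]) (auto simp: comp_def)
next
  case (evals_PrimRec_Suc f g n xs r y)
  then obtain s t where st: "bounded_eval (PrimRec f g) s (n # xs) = Suc r"
    "bounded_eval g t (r # n # xs) = Suc y" by blast
  have "bounded_eval (PrimRec f g) (max s t) (n # xs) = Suc r"
    using st(1) by (rule bounded_eval_mono[rotated]) simp
  moreover have "bounded_eval g (max s t) (r # n # xs) = Suc y"
    using st(2) by (rule bounded_eval_mono[rotated]) simp
  ultimately show ?case by (intro exI[of _ "max s t"]) simp
next
  case (evals_Mu f n xs)
  obtain s0 where s0: "bounded_eval f s0 (n # xs) = 1" using evals_Mu.IH(1) by auto
  have "\<exists>s. \<forall>m<n'. \<exists>k. bounded_eval f s (m # xs) = Suc (Suc k)" if "n' \<le> n" for n'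
    using that
  proof (induction n')
    case (Suc n')
    then obtain s where s: "\<forall>m<n'. \<exists>k. bounded_eval f s (m # xs) = Suc (Suc k)" by auto
    obtain t k where t: "bounded_eval f t (n' # xs) = Suc (Suc k)"
      using evals_Mu.IH(2) Suc.prems by (metis less_eq_Suc_le)
    have "bounded_eval f (max s t) (n' # xs) = Suc (Suc k)"
      using t by (rule bounded_eval_mono[rotated]) simp
    moreover have "\<exists>k. bounded_eval f (max s t) (m # xs) = Suc (Suc k)" if "m < n'" for m
      using s that by (meson bounded_eval_mono max.cobounded1)
    ultimately show ?case by (auto simp: less_Suc_eq)
  qed simp
  then obtain s1 where s1: "\<And>m. m < n \<Longrightarrow> \<exists>k. bounded_eval f s1 (m # xs) = Suc (Suc k)" by blast
  \<comment> \<open>Besides serving all values up to n, the bound has to exceed n itself, since the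
    search is cut off at \<open>s\<close>.\<close>
  define s where "s = max (Suc n) (max s0 s1)"
  have "s0 \<le> s" "s1 \<le> s" "n < s" by (auto simp: s_def)
  have 1: "bounded_eval f s (n # xs) = 1"
    using bounded_eval_mono[OF \<open>s0 \<le> s\<close>] s0 by simp
  have 2: "\<exists>k. bounded_eval f s (m # xs) = Suc (Suc k)" if "m < n" for m
    using bounded_eval_mono[OF \<open>s1 \<le> s\<close>] s1[OF that] by blast
  have "(LEAST n. s \<le> n \<or> bounded_eval f s (n # xs) \<le> 1) = n"
  proof (rule Least_equality)
    fix m assume m: "s \<le> m \<or> bounded_eval f s (m # xs) \<le> 1"
    show "n \<le> m"
    proof (rule ccontr)
      assume "\<not> n \<le> m"
      with 2[of m] m \<open>n < s\<close> show False by auto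
    qed
  qed (simp add: 1)
  then show ?case using 1 \<open>n < s\<close> by (auto simp: Let_def intro!: exI[of _ s])
qed auto

lemma evals_iff_bounded_eval: "evals r xs y \<longleftrightarrow> (\<exists>s. bounded_eval r s xs = Suc y)"
  using bounded_eval_of_evals evals_of_bounded_eval by blast

section \<open>Transfer between recursive functions of fixed arity and computable ones\<close>

lemma partial_recursive_halting_approx:
  assumes "partial_recursive 2 (\<lambda>xs. \<phi> (xs ! 0) (xs ! 1))"
  obtains H :: "nat \<Rightarrow> nat \<Rightarrow> nat \<Rightarrow> bool" where
    "computable (\<lambda>p. H (fst p) (fst (snd p)) (snd (snd p)))"
    "\<And>e x s t. s \<le> t \<Longrightarrow> H s e x \<Longrightarrow> H t e x"
    "\<And>e x. x \<in> dom (\<phi> e) \<longleftrightarrow> (\<exists>s. H s e x)"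
proof -
  from assms obtain r where r: "\<And>xs y. length xs = 2 \<Longrightarrow> evals r xs y \<longleftrightarrow> \<phi> (xs ! 0) (xs ! 1) = Some y"
    unfolding partial_recursive_def by blast
  define H where "H s e x \<longleftrightarrow> bounded_eval r s [e, x] \<noteq> 0" for s e x
  show ?thesis
  proof
    show "computable (\<lambda>p. H (fst p) (fst (snd p)) (snd (snd p)))"
      unfolding H_def by (intro computable_intros computable_comp2[OF computable_bounded_eval])
    show "H t e x" if "s \<le> t" "H s e x" for e x s t
      using bounded_eval_mono[OF that(1), of r "[e, x]" "bounded_eval r s [e, x] - 1"] that(2)
      unfolding H_def by simp
    show "x \<in> dom (\<phi> e) \<longleftrightarrow> (\<exists>s. H s e x)" for e x
      using r[of "[e, x]"] unfolding H_def evals_iff_bounded_eval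
      by (fastforce simp: dom_def gr0_conv_Suc)
  qed
qed

lemma partial_recursive_domain:
  assumes "computable (\<lambda>p. P (fst p) (snd p))"
  shows "partial_recursive 2 (\<lambda>xs. if P (xs ! 0) (xs ! 1) then Some 0 else None)"
proof -
  have "computable (\<lambda>p. if P (fst p) (snd p) then 0 else Suc 0)"
    by (intro computable_intros assms)
  then obtain r where r: "\<And>p. evals r [encode p] (if P (fst p) (snd p) then 0 else Suc 0)"
    unfolding computable_def encode_nat_def by blast
  \<comment> \<open>The search variable \<open>Proj 0\<close> is ignored: the search ends at 0 if
    \<open>P\<close> holds and never otherwise.\<close>
  let ?r = "Comp r [Comp pair_term [Proj 1, Proj 2]]"
  have r': "evals ?r [n, e, x] (if P e x then 0 else Suc 0)" for n e x
    using r[of "(e, x)"]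
    by (intro evals_Comp1[of _ _ "prod_encode (e, x)"] evals_Comp2[OF _ _ evals_pair_term])
      (auto intro: evals_Proj_nth)
  show ?thesis
    unfolding partial_recursive_def
  proof (intro exI[of _ "Mu ?r"] allI impI)
    fix xs :: "nat list" and y
    assume "length xs = 2"
    then obtain e x where xs: "xs = [e, x]" by (metis length_0_conv length_Suc_conv numeral_2_eq_2)
    have "evals (Mu ?r) [e, x] y \<longleftrightarrow> P e x \<and> y = 0"
    proof
      assume "evals (Mu ?r) [e, x] y"
      then have y: "evals ?r [y, e, x] 0" "\<forall>m<y. \<exists>k. evals ?r [m, e, x] (Suc k)"
        by (auto elim: evals.cases)
      have "P e x" using evals_deterministic[OF y(1) r'] by (auto split: if_splits)
      moreover have "y = 0"
      proof (rule ccontr)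
        assume "y \<noteq> 0"
        with y(2) obtain k where "evals ?r [0, e, x] (Suc k)" by auto
        from evals_deterministic[OF this r'] \<open>P e x\<close> show False by simp
      qed
      ultimately show "P e x \<and> y = 0" by simp
    next
      assume *: "P e x \<and> y = 0"
      with r'[of 0 e x] show "evals (Mu ?r) [e, x] y" by (auto intro!: evals_Mu)
    qed
    then show "evals (Mu ?r) xs y \<longleftrightarrow> (if P (xs ! 0) (xs ! 1) then Some 0 else None) = Some y"
      by (auto simp: xs)
  qed
qed

lemma recursive_iff_evals: "recursive n f \<longleftrightarrow> (\<exists>r. \<forall>xs. length xs = n \<longrightarrow> evals r xs (f xs))"
  unfolding recursive_def partial_recursive_def by (auto dest: evals_deterministic)

lemma recursive_pred_4_iff:
  "recursive_pred 4 R \<longleftrightarrow>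
    computable (\<lambda>p :: nat \<times> nat \<times> nat \<times> nat.
      R [fst p, fst (snd p), fst (snd (snd p)), snd (snd (snd p))])"
    (is "_ \<longleftrightarrow> computable ?f")
proof
  assume "recursive_pred 4 R"
  then obtain r where r: "\<And>xs. length xs = 4 \<Longrightarrow> evals r xs (of_bool (R xs))"
    unfolding recursive_pred_def recursive_iff_evals by blast
  let ?s = "Comp r [fst_term, Comp fst_term [snd_term], Comp fst_term [Comp snd_term [snd_term]],
    Comp snd_term [Comp snd_term [snd_term]]]"
  have "evals ?s [encode (a, b, c, d)] (encode (?f (a, b, c, d)))" for a b c d :: nat
  proof -
    have 1: "evals snd_term [encode (a, b, c, d)] (prod_encode (b, prod_encode (c, d)))"
      by (simp add: evals_snd_term)
    have 2: "evals (Comp snd_term [snd_term]) [encode (a, b, c, d)] (prod_encode (c, d))"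
      by (rule evals_Comp1[OF 1 evals_snd_term])
    have "evals ?s [encode (a, b, c, d)] (of_bool (R [a, b, c, d]))"
      by (rule evals_Comp4[OF _ evals_Comp1[OF 1 evals_fst_term] evals_Comp1[OF 2 evals_fst_term]
            evals_Comp1[OF 2 evals_snd_term] r])
        (simp_all add: evals_fst_term)
    then show ?thesis by simp
  qed
  then show "computable ?f" by (intro computableI[of ?s]) (metis prod.collapse)
next
  assume "computable ?f"
  then obtain r where r: "\<And>p. evals r [encode p] (encode (?f p))"
    unfolding computable_def by blast
  let ?s = "Comp r [Comp pair_term [Proj 0, Comp pair_term [Proj 1, Comp pair_term [Proj 2, Proj 3]]]]"
  have "evals ?s xs (of_bool (R xs))" if "length xs = 4" for xs
  proof -
    from that obtain a b c d where xs: "xs = [a, b, c, d]"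
      by (auto simp: numeral_eq_Suc length_Suc_conv)
    have "evals (Comp pair_term [Proj 0, Comp pair_term [Proj 1, Comp pair_term [Proj 2, Proj 3]]]) xs
        (prod_encode (a, prod_encode (b, prod_encode (c, d))))"
      by (intro evals_Comp2[OF _ _ evals_pair_term] evals_Proj_nth) (auto simp: xs)
    then show ?thesis using r[of "(a, b, c, d)"] by (auto intro: evals_Comp1 simp: xs)
  qed
  then show "recursive_pred 4 R"
    unfolding recursive_pred_def recursive_iff_evals by blast
qed

section \<open>Dyadic approximations\<close>

text \<open>Shows \<open>len x\<close> to be the number of binary digits of x (none for 0), which
  trades the logarithm for a decidable comparison.\<close>

lemma le_len_iff: "len x \<le> l \<longleftrightarrow> x < 2 ^ l"
proof -
  have "len x \<le> l \<longleftrightarrow> log 2 (real x + 1) \<le> real l"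
    unfolding len_def by (simp add: ceiling_le_iff nat_le_iff)
  also have "\<dots> \<longleftrightarrow> real x + 1 \<le> 2 powr real l"
    by (rule log_le_iff) auto
  also have "\<dots> \<longleftrightarrow> real (x + 1) \<le> real (2 ^ l)"
    by (simp add: powr_realpow add.commute)
  also have "\<dots> \<longleftrightarrow> x < 2 ^ l"
    unfolding of_nat_le_iff by auto
  finally show ?thesis .
qed

lemma len_eq_LEAST: "len x = (LEAST l. x < 2 ^ l)"
  by (rule Least_equality[symmetric]) (auto simp flip: le_len_iff)

lemma len_eq_Suc: "2 ^ i \<le> x \<Longrightarrow> x < 2 ^ Suc i \<Longrightarrow> len x = Suc i"
  using le_len_iff[of x i] le_len_iff[of x "Suc i"] by linarith

lemma computable_len [computable_intros]:
  assumes "computable f"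
  shows "computable (\<lambda>x. len (f x))"
proof (rule computable_comp[OF _ assms])
  show "computable len"
    unfolding len_eq_LEAST[abs_def]
    by (intro computable_intros) (rule exI, rule less_exp)
qed

text \<open>\<open>k s\<close> is a numerator over \<open>2 ^ s\<close>; the doubling inequality
  says that the fractions increase, without leaving the natural numbers.\<close>

definition dyadic_limit :: "(nat \<Rightarrow> nat) \<Rightarrow> real \<Rightarrow> bool" where
  "dyadic_limit k a \<longleftrightarrow> (\<forall>s. k s \<le> 2 ^ s) \<and> (\<forall>s. 2 * k s \<le> k (Suc s)) \<and>
     (\<lambda>s. real (k s) / 2 ^ s) \<longlonglongrightarrow> a"

lemma dyadic_limitD:
  assumes "dyadic_limit k a"
  shows "k s \<le> 2 ^ s" "2 * k s \<le> k (Suc s)" "(\<lambda>s. real (k s) / 2 ^ s) \<longlonglongrightarrow> a"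
  using assms unfolding dyadic_limit_def by auto

lemma incseq_dyadic:
  assumes "\<And>s. 2 * k s \<le> k (Suc s)"
  shows "incseq (\<lambda>s. real (k s) / 2 ^ s)"
proof (rule incseq_SucI)
  fix s
  have "2 * real (k s) \<le> real (k (Suc s))" using assms[of s] by linarith
  then show "real (k s) / 2 ^ s \<le> real (k (Suc s)) / 2 ^ Suc s" by (simp add: field_simps)
qed

lemma dyadic_limit_mono:
  assumes "dyadic_limit k a" "s \<le> t"
  shows "real (k s) / 2 ^ s \<le> real (k t) / 2 ^ t"
  using incseqD[OF incseq_dyadic[of k, OF dyadic_limitD(2)[OF assms(1)]] assms(2)] .

lemma dyadic_limit_ge: "dyadic_limit k a \<Longrightarrow> real (k s) / 2 ^ s \<le> a"
  using incseq_le[OF incseq_dyadic[of k] dyadic_limitD(3)[of k a]] dyadic_limitD(2)[of k a] by blast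

lemma dyadic_limit_range: "dyadic_limit k a \<Longrightarrow> a \<in> {0..1}"
proof -
  assume k: "dyadic_limit k a"
  have "real (k s) / 2 ^ s \<le> 1" for s
    using dyadic_limitD(1)[OF k, of s] by (simp flip: of_nat_le_iff)
  then have "a \<le> 1" by (intro LIMSEQ_le_const2[OF dyadic_limitD(3)[OF k]]) auto
  moreover have "0 \<le> real (k 0) / 2 ^ 0" by simp
  ultimately show ?thesis using dyadic_limit_ge[OF k, of 0] by simp
qed

lemma dyadic_limit_less_pow: "dyadic_limit k a \<Longrightarrow> a < 1 \<Longrightarrow> k s < 2 ^ s"
proof -
  assume "dyadic_limit k a" "a < 1"
  then have "real (k s) / 2 ^ s < 1" using dyadic_limit_ge[of k a s] by linarith
  then have "real (k s) < 2 ^ s" by (simp add: field_simps)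
  then show ?thesis by simp
qed

section \<open>Numberings as uniformly computable families of approximations\<close>

definition dyadic_approx :: "(nat \<Rightarrow> nat \<Rightarrow> nat) \<Rightarrow> (nat \<Rightarrow> real) \<Rightarrow> bool" where
  "dyadic_approx K \<alpha> \<longleftrightarrow> computable (\<lambda>p. K (fst p) (snd p)) \<and> (\<forall>e. dyadic_limit (K e) (\<alpha> e))"

lemma dyadic_approx_of_numbering:
  assumes "left_re_numbering \<alpha>"
  obtains K where "dyadic_approx K \<alpha>"
proof -
  from assms obtain \<phi> where pr: "partial_recursive 2 (\<lambda>xs. \<phi> (xs ! 0) (xs ! 1))"
    and range: "\<And>e. \<alpha> e \<in> {0..1}"
    and sum: "\<And>e. ((\<lambda>x. 1 / 2 ^ len x) has_sum \<alpha> e) (dom (\<phi> e))"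
    unfolding left_re_numbering_def by blast
  obtain H :: "nat \<Rightarrow> nat \<Rightarrow> nat \<Rightarrow> bool" where H: "computable (\<lambda>p. H (fst p) (fst (snd p)) (snd (snd p)))"
    and mono: "\<And>e x s t. s \<le> t \<Longrightarrow> H s e x \<Longrightarrow> H t e x"
    and dom: "\<And>e x. x \<in> dom (\<phi> e) \<longleftrightarrow> (\<exists>s. H s e x)"
    using partial_recursive_halting_approx[of \<phi>, OF pr] by blast
  \<comment> \<open>The restriction x < \<open>2 ^ s\<close> means \<open>len x \<le> s\<close>, so
    each weight is a multiple of \<open>1 / 2 ^ s\<close> and the sum is a natural
    numerator.\<close>
  define K :: "nat \<Rightarrow> nat \<Rightarrow> nat" where
    "K e s = (\<Sum>x<2 ^ s. if H s e x then 2 ^ (s - len x) else 0)" for e s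
  define F where "F e s = {x. x < 2 ^ s \<and> H s e x}" for e s
  have comp: "computable (\<lambda>p. K (fst p) (snd p))"
    unfolding K_def by (intro computable_intros computable_comp3[OF H])
  have step: "2 * K e s \<le> K e (Suc s)" for e s
  proof -
    have "2 * K e s = (\<Sum>x<2 ^ s. if H s e x then 2 ^ (Suc s - len x) else 0)"
      unfolding K_def sum_distrib_left
      by (rule sum.cong) (auto simp: Suc_diff_le simp flip: le_len_iff)
    also have "\<dots> \<le> (\<Sum>x<2 ^ s. if H (Suc s) e x then 2 ^ (Suc s - len x) else 0)"
      using mono[of s "Suc s" e] by (intro sum_mono) auto
    also have "\<dots> \<le> K e (Suc s)"
      unfolding K_def by (rule sum_mono2) auto
    finally show ?thesis .
  qed
  have K_F: "real (K e s) / 2 ^ s = (\<Sum>x\<in>F e s. 1 / 2 ^ len x)" for e s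
  proof -
    have "real (K e s) / 2 ^ s = (\<Sum>x<2 ^ s. if H s e x then 1 / 2 ^ len x else 0)"
      unfolding K_def of_nat_sum sum_divide_distrib
    proof (rule sum.cong)
      fix x :: nat assume "x \<in> {..<2 ^ s}"
      then have "len x \<le> s" by (simp add: le_len_iff)
      then show "real (if H s e x then 2 ^ (s - len x) else 0) / 2 ^ s =
          (if H s e x then 1 / 2 ^ len x else 0)"
        by (simp add: field_simps flip: power_add)
    qed simp
    also have "\<dots> = (\<Sum>x\<in>F e s. 1 / 2 ^ len x)"
      unfolding F_def by (subst sum.inter_filter[symmetric]) (auto intro: sum.cong)
    finally show ?thesis .
  qed
  have lim: "(\<lambda>s. real (K e s) / 2 ^ s) \<longlonglongrightarrow> \<alpha> e" for e
  proof -
    \<comment> \<open>The finite sets \<open>F e s\<close> eventually contain each finite part of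
      the domain, so the unordered sum is the limit along them.\<close>
    have "filterlim (F e) (finite_subsets_at_top (dom (\<phi> e))) sequentially"
      unfolding filterlim_finite_subsets_at_top
    proof (intro allI impI)
      fix X assume X: "finite X \<and> X \<subseteq> dom (\<phi> e)"
      have "\<forall>\<^sub>F s in sequentially. x \<in> F e s" if x: "x \<in> X" for x
      proof -
        obtain t where t: "H t e x" using x X dom by blast
        show ?thesis
        proof (rule eventually_sequentiallyI)
          fix s assume s: "max t x \<le> s"
          then have "x < 2 ^ s" using less_exp[of s] by linarith
          then show "x \<in> F e s" using mono[OF _ t, of s] s by (simp add: F_def)
        qed
      qed
      then have "\<forall>\<^sub>F s in sequentially. \<forall>x\<in>X. x \<in> F e s"
        using X by (simp add: eventually_ball_finite)
      then show "\<forall>\<^sub>F s in sequentially. finite (F e s) \<and> X \<subseteq> F e s \<and> F e s \<subseteq> dom (\<phi> e)"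
      proof eventually_elim
        case (elim s)
        have "F e s \<subseteq> dom (\<phi> e)" using dom unfolding F_def by blast
        then show ?case using elim by (auto simp: F_def)
      qed
    qed
    from filterlim_compose[OF sum[of e, unfolded has_sum_def] this] show ?thesis
      by (simp add: K_F)
  qed
  have "K e s \<le> 2 ^ s" for e s
  proof -
    have "real (K e s) / 2 ^ s \<le> 1"
      using incseq_le[OF incseq_dyadic[of "K e", OF step] lim, of s] range[of e]
      unfolding atLeastAtMost_iff by linarith
    then have "real (K e s) \<le> 2 ^ s" by (simp add: field_simps)
    then show ?thesis by simp
  qed
  with step lim comp show ?thesis
    by (intro that[of K]) (auto simp: dyadic_approx_def dyadic_limit_def)
qed

lemma incseq_subseq_tendsto:
  fixes X :: "nat \<Rightarrow> real"
  assumes "incseq X" "strict_mono r" "(\<lambda>n. X (r n)) \<longlonglongrightarrow> a"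
  shows "X \<longlonglongrightarrow> a"
proof -
  have "incseq (\<lambda>n. X (r n))"
    using assms(1) strict_mono_less_eq[OF assms(2)] unfolding incseq_def by blast
  then have le: "X (r n) \<le> a" for n using assms(3) by (rule incseq_le)
  have "X n \<le> a" for n
    using le[of n] incseqD[OF assms(1) strict_mono_imp_increasing[OF assms(2), of n]] by simp
  then obtain L where L: "X \<longlonglongrightarrow> L" using incseq_convergent[OF assms(1), of a] by blast
  then have "(\<lambda>n. X (r n)) \<longlonglongrightarrow> L"
    using LIMSEQ_subseq_LIMSEQ[OF L assms(2)] by (simp add: comp_def)
  with assms(3) L show ?thesis using LIMSEQ_unique by blast
qed

text \<open>The length-\<open>i + 1\<close> numbers carry total weight only \<open>1/2\<close>, whereas a dyadic approximation \<open>q\<close>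
  may increase by more than that in one stage.  The means \<open>(q (i - 1) + q i) / 2\<close> increase by
  \<open>(q i - q (i - 2)) / 2\<close>, which does fit.\<close>

lemma numbering_of_dyadic_approx:
  assumes "dyadic_approx K \<alpha>"
  shows "left_re_numbering \<alpha>"
proof -
  from assms have comp: "computable (\<lambda>p. K (fst p) (snd p))"
    and K: "\<And>e. dyadic_limit (K e) (\<alpha> e)"
    unfolding dyadic_approx_def by auto
  \<comment> \<open>The number of arguments of length i + 1 to be put into the domain. The factor 4
    brings the numerator from two stages back over \<open>2 ^ i\<close>; for i < 2 the missing
    earlier approximations count as 0.\<close>
  define c where "c e i = (if i < 2 then K e i else K e i - 4 * K e (i - 2))" for e i
  \<comment> \<open>The domain takes an initial segment of each block of equal length. The number 0
    has to be excluded: \<open>len 0 - 1\<close> truncates to 0 and would put it into the block of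
    1.\<close>
  define P where "P e x \<longleftrightarrow> 0 < x \<and> x < 2 ^ (len x - 1) + c e (len x - 1)" for e x
  define \<phi> where "\<phi> e x = (if P e x then Some (0::nat) else None)" for e x
  have "computable (\<lambda>p. P (fst p) (snd p))"
    unfolding P_def c_def by (intro computable_intros computable_comp2[OF comp])
  then have pr: "partial_recursive 2 (\<lambda>xs. \<phi> (xs ! 0) (xs ! 1))"
    unfolding \<phi>_def by (rule partial_recursive_domain[of P])
  have "((\<lambda>x. 1 / 2 ^ len x) has_sum \<alpha> e) (dom (\<phi> e))" for e
  proof -
    note D = dyadic_limitD[OF K[of e]]
    define q where "q i = real (K e i) / 2 ^ i" for i
    have c_le: "c e i \<le> 2 ^ i" for i
      unfolding c_def using D(1)[of i] by auto
    have four: "4 * K e i \<le> K e (Suc (Suc i))" for i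
      using D(2)[of i] D(2)[of "Suc i"] by linarith
    have c_eq: "real (c e (Suc (Suc i))) / 2 ^ Suc (Suc (Suc i)) = (q (Suc (Suc i)) - q i) / 2" for i
      using four[of i] unfolding c_def q_def
      by (simp add: of_nat_diff field_simps)
    have telescope: "(\<Sum>i<Suc (Suc n). real (c e i) / 2 ^ Suc i) = (q n + q (Suc n)) / 2" for n
    proof (induction n)
      case 0
      show ?case by (simp add: c_def q_def)
    next
      case (Suc n)
      have "(\<Sum>i<Suc (Suc (Suc n)). real (c e i) / 2 ^ Suc i) =
          (q n + q (Suc n)) / 2 + (q (Suc (Suc n)) - q n) / 2"
        unfolding sum.lessThan_Suc[of _ "Suc (Suc n)"] Suc c_eq ..
      then show ?case by (simp add: field_simps)
    qed
    define g where "g x = (if P e x then 1 / 2 ^ len x else 0 :: real)" for x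
    have block: "sum g {2 ^ i..<2 ^ Suc i} = real (c e i) / 2 ^ Suc i" for i
    proof -
      have "sum g {2 ^ i..<2 ^ Suc i} = (\<Sum>x\<in>{2 ^ i..<2 ^ Suc i}. if x < 2 ^ i + c e i then 1 / 2 ^ Suc i else 0)"
      proof (rule sum.cong)
        fix x :: nat assume x: "x \<in> {2 ^ i..<2 ^ Suc i}"
        then have "len x = Suc i" by (intro len_eq_Suc) auto
        moreover have "0 < x" using x less_le_trans[of 0 "2 ^ i" x] by simp
        ultimately show "g x = (if x < 2 ^ i + c e i then 1 / 2 ^ Suc i else 0)"
          by (simp add: g_def P_def)
      qed simp
      also have "\<dots> = (\<Sum>x\<in>{2 ^ i..<2 ^ i + c e i}. 1 / 2 ^ Suc i)"
        using c_le[of i] by (intro sum.mono_neutral_cong_right) auto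
      finally show ?thesis by simp
    qed
    have partial: "sum g {..<2 ^ n} = (\<Sum>i<n. real (c e i) / 2 ^ Suc i)" for n
    proof (induction n)
      case 0
      show ?case by (simp add: g_def P_def)
    next
      case (Suc n)
      have "{..<2 ^ Suc n} = {..<2 ^ n} \<union> {2 ^ n..<2 ^ Suc n :: nat}"
        by auto
      moreover have "sum g ({..<2 ^ n} \<union> {2 ^ n..<2 ^ Suc n}) = sum g {..<2 ^ n} + sum g {2 ^ n..<2 ^ Suc n}"
        by (rule sum.union_disjoint) auto
      ultimately show ?case unfolding block Suc.IH sum.lessThan_Suc[of _ n] by simp
    qed
    have "q \<longlonglongrightarrow> \<alpha> e" unfolding q_def by (rule D(3))
    then have "(\<lambda>n. (q n + q (Suc n)) / 2) \<longlonglongrightarrow> (\<alpha> e + \<alpha> e) / 2"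
      by (intro tendsto_intros LIMSEQ_Suc) auto
    then have lim: "(\<lambda>n. sum g {..<2 ^ Suc (Suc n)}) \<longlonglongrightarrow> \<alpha> e"
      unfolding partial telescope by simp
    \<comment> \<open>The partial sums are known at powers of two only; as \<open>g\<close> is
      nonnegative, this subsequence decides the limit.\<close>
    have "(\<lambda>n. sum g {..<n}) \<longlonglongrightarrow> \<alpha> e"
    proof (rule incseq_subseq_tendsto[where r = "\<lambda>n. 2 ^ Suc (Suc n)", OF _ _ lim])
      show "incseq (\<lambda>n. sum g {..<n})"
        by (rule incseq_SucI) (simp add: g_def)
      show "strict_mono (\<lambda>n. 2 ^ Suc (Suc n) :: nat)" by (rule strict_monoI) simp
    qed
    then have "g sums \<alpha> e" unfolding sums_def by simp
    then have "(g has_sum \<alpha> e) UNIV"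
      by (rule sums_nonneg_imp_has_sum) (simp add: g_def)
    then show ?thesis
      by (rule has_sum_cong_neutral[THEN iffD1, rotated -1]) (auto simp: g_def \<phi>_def split: if_splits)
  qed
  with pr show ?thesis
    unfolding left_re_numbering_def using dyadic_limit_range[OF K] by blast
qed

section \<open>Infinite and shift-persistent reals\<close>

lemma summable_bits: "summable (\<lambda>n. of_bool (b n) / 2 ^ Suc n :: real)"
proof (rule summable_comparison_test')
  show "summable (\<lambda>n. (1 / 2) ^ Suc n :: real)"
    using summable_geometric[of "1 / 2 :: real"] by (subst summable_Suc_iff) simp
  show "norm (of_bool (b n) / 2 ^ Suc n :: real) \<le> (1 / 2) ^ Suc n" for n
    by (simp add: power_one_over)
qed

lemma real_of_bits_head:
  "real_of_bits b = (of_bool (b 0) + real_of_bits (\<lambda>n. b (Suc n))) / 2"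
proof -
  have "real_of_bits b = (\<Sum>n. of_bool (b (Suc n)) / 2 ^ Suc (Suc n)) + of_bool (b 0) / 2 ^ Suc 0"
    unfolding real_of_bits_def using suminf_split_head[OF summable_bits[of b]] by simp
  also have "(\<Sum>n. of_bool (b (Suc n)) / 2 ^ Suc (Suc n)) = (\<Sum>n. of_bool (b (Suc n)) / 2 ^ Suc n / (2::real))"
    by (simp add: field_simps)
  also have "\<dots> = real_of_bits (\<lambda>n. b (Suc n)) / 2"
    unfolding real_of_bits_def using suminf_divide[OF summable_bits[of "\<lambda>n. b (Suc n)"], of 2] by simp
  finally show ?thesis by (simp add: add_divide_distrib)
qed

lemma real_of_bits_bounds: "0 \<le> real_of_bits b" "real_of_bits b \<le> 1"
proof -
  show "0 \<le> real_of_bits b" unfolding real_of_bits_def by (rule suminf_nonneg[OF summable_bits]) simp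
  have *: "(\<lambda>n. (1 / 2 :: real) ^ Suc n) sums 1" by (rule power_half_series)
  show "real_of_bits b \<le> 1"
    unfolding real_of_bits_def
    using suminf_le[OF _ summable_bits sums_summable[OF *], of b] sums_unique[OF *]
    by (simp add: power_one_over)
qed

lemma real_of_bits_pos: "b n \<Longrightarrow> 0 < real_of_bits b"
proof (induction n arbitrary: b)
  case 0
  then show ?case using real_of_bits_head[of b] real_of_bits_bounds(1)[of "\<lambda>n. b (Suc n)"] by simp
next
  case (Suc n)
  have "0 < real_of_bits (\<lambda>n. b (Suc n))" by (rule Suc.IH) (rule Suc.prems)
  then show ?case using real_of_bits_head[of b] by (cases "b 0") auto
qed

lemma real_of_bits_less_1: "\<not> b n \<Longrightarrow> real_of_bits b < 1"
proof (induction n arbitrary: b)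
  case 0
  then show ?case using real_of_bits_head[of b] real_of_bits_bounds(2)[of "\<lambda>n. b (Suc n)"] by simp
next
  case (Suc n)
  have "real_of_bits (\<lambda>n. b (Suc n)) < 1" by (rule Suc.IH) (rule Suc.prems)
  then show ?case using real_of_bits_head[of b] by (cases "b 0") auto
qed

lemma INFM_Suc_iff: "(\<exists>\<^sub>\<infinity>n. P (Suc n)) \<longleftrightarrow> (\<exists>\<^sub>\<infinity>n. P n)"
  unfolding frequently_def cofinite_eq_sequentially eventually_sequentially_Suc[of "\<lambda>n. \<not> P n"] ..

text \<open>Stripping the leading bit lowers the exponent by one. At exponent 0 the occurrence of
  both bits puts the real strictly between 0 and 1, away from the integers.\<close>

lemma real_of_bits_not_dyadic:
  assumes "\<exists>\<^sub>\<infinity>n. \<not> b n" "\<exists>\<^sub>\<infinity>n. b n"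
  shows "real_of_bits b \<noteq> of_int k / 2 ^ n"
  using assms
proof (induction n arbitrary: b k)
  case 0
  obtain i j where "b i" "\<not> b j" using 0 unfolding INFM_nat by blast
  then have "0 < real_of_bits b" "real_of_bits b < 1"
    using real_of_bits_pos real_of_bits_less_1 by blast+
  then show ?case by auto
next
  case (Suc n)
  let ?b = "\<lambda>n. b (Suc n)"
  have inf: "\<exists>\<^sub>\<infinity>n. \<not> ?b n" "\<exists>\<^sub>\<infinity>n. ?b n"
    using Suc.prems INFM_Suc_iff[of "\<lambda>n. \<not> b n"] INFM_Suc_iff[of b] by simp_all
  show ?case
  proof
    assume "real_of_bits b = of_int k / 2 ^ Suc n"
    then have "real_of_bits ?b = of_int (k - of_bool (b 0) * 2 ^ n) / 2 ^ n"
      using real_of_bits_head[of b] by (simp add: field_simps)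
    with Suc.IH[OF inf] show False by blast
  qed
qed

lemma infinite_real_not_dyadic:
  assumes "infinite_real X"
  shows "X \<noteq> real k / 2 ^ n"
  using assms real_of_bits_not_dyadic[of _ "int k" n] unfolding infinite_real_def by auto

lemma infinite_real_bounds:
  assumes "infinite_real X"
  shows "0 < X" "X < 1"
proof -
  obtain b where b: "X = real_of_bits b" using assms unfolding infinite_real_def by blast
  show "0 < X" using infinite_real_not_dyadic[OF assms, of 0 0] real_of_bits_bounds(1)[of b] b by simp
  show "X < 1" using infinite_real_not_dyadic[OF assms, of 1 0] real_of_bits_bounds(2)[of b] b by simp
qed

lemma real_of_bits_Cons_conc: "real_of_bits ((a # \<sigma>) \<frown> b) = (of_bool a + real_of_bits (\<sigma> \<frown> b)) / 2"
proof -
  have "(\<lambda>n. ((a # \<sigma>) \<frown> b) (Suc n)) = \<sigma> \<frown> b" by (auto simp: conc_def)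
  then show ?thesis using real_of_bits_head[of "(a # \<sigma>) \<frown> b"] by simp
qed

text \<open>The string is k written with n binary digits; the top digit is found by comparing k with
  half of the range.\<close>

lemma ex_conc_real_of_bits:
  "k < 2 ^ n \<Longrightarrow> \<exists>\<sigma>. real_of_bits (\<sigma> \<frown> b) = (real k + real_of_bits b) / 2 ^ n"
proof (induction n arbitrary: k)
  case 0
  show ?case by (rule exI[of _ "[]"]) (use 0 in simp)
next
  case (Suc n)
  show ?case
  proof (cases "k < 2 ^ n")
    case True
    then obtain \<sigma> where "real_of_bits (\<sigma> \<frown> b) = (real k + real_of_bits b) / 2 ^ n"
      using Suc.IH by blast
    then show ?thesis
      by (intro exI[of _ "False # \<sigma>"]) (unfold real_of_bits_Cons_conc, simp)
  next
    case False
    then have "k - 2 ^ n < 2 ^ n" using Suc.prems by auto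
    then obtain \<sigma> where "real_of_bits (\<sigma> \<frown> b) = (real (k - 2 ^ n) + real_of_bits b) / 2 ^ n"
      using Suc.IH by blast
    then show ?thesis using False
      by (intro exI[of _ "True # \<sigma>"]) (unfold real_of_bits_Cons_conc, simp add: of_nat_diff field_simps)
  qed
qed

lemma shift_persistent_dyadic_shift:
  assumes "shift_persistent C X" "k < 2 ^ n"
  shows "(real k + X) / 2 ^ n \<in> C"
  using assms ex_conc_real_of_bits[OF assms(2)] unfolding shift_persistent_def by metis

section \<open>Numberings and \<open>\<Sigma>\<^sub>3\<close> index sets\<close>

text \<open>Since the approximations increase, an estimate at a late stage bounds all earlier ones,
  and its error tends to 0.\<close>

lemma dyadic_limit_le:
  assumes "dyadic_limit k a" and "\<And>s. \<exists>t\<ge>s. real (k t) / 2 ^ t \<le> b + 1 / 2 ^ t"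
  shows "a \<le> b"
proof -
  have "(\<lambda>s. b + 1 / 2 ^ s) \<longlonglongrightarrow> b + 0"
    using LIMSEQ_power_zero[of "1 / 2 :: real"]
    by (intro tendsto_intros) (simp add: power_one_over)
  moreover have "real (k s) / 2 ^ s \<le> b + 1 / 2 ^ s" for s
  proof -
    obtain t where t: "s \<le> t" "real (k t) / 2 ^ t \<le> b + 1 / 2 ^ t" using assms(2) by blast
    have "(1::real) / 2 ^ t \<le> 1 / 2 ^ s" using t(1) by (simp add: frac_le)
    with t(2) dyadic_limit_mono[OF assms(1) t(1)] show ?thesis by linarith
  qed
  ultimately show ?thesis
    using LIMSEQ_le[OF dyadic_limitD(3)[OF assms(1)], of "\<lambda>s. b + 1 / 2 ^ s" b] by auto
qed

lemma dyadic_less_iff: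
  "real k / 2 ^ s < real l / 2 ^ t + 1 / 2 ^ s \<longleftrightarrow> k * 2 ^ t < l * 2 ^ s + 2 ^ t"
proof -
  have "real k / 2 ^ s < real l / 2 ^ t + 1 / 2 ^ s \<longleftrightarrow>
      real k * 2 ^ t < real l * 2 ^ s + 2 ^ t"
    by (simp add: field_simps)
  also have "\<dots> \<longleftrightarrow> real (k * 2 ^ t) < real (l * 2 ^ s + 2 ^ t)" by simp
  finally show ?thesis unfolding of_nat_less_iff .
qed

text \<open>The limits agree iff each approximation is eventually reached by the other side up to
  \<open>1 / 2 ^ s\<close>. The slack covers a side that attains the limit while the other merely
  approaches it; clearing denominators makes the comparison decidable.\<close>

lemma dyadic_limit_eq_iff:
  assumes k: "dyadic_limit k a" and l: "dyadic_limit l b"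
  shows "a = b \<longleftrightarrow> (\<forall>s. \<exists>t. k s * 2 ^ t < l t * 2 ^ s + 2 ^ t \<and> l s * 2 ^ t < k t * 2 ^ s + 2 ^ t)"
    (is "_ \<longleftrightarrow> ?R")
proof
  assume eq: "a = b"
  show ?R
  proof
    fix s
    have "\<forall>\<^sub>F t in sequentially. a - 1 / 2 ^ s < real (l t) / 2 ^ t"
      using dyadic_limitD(3)[OF l] eq by (intro order_tendstoD(1)[of _ b]) auto
    moreover have "\<forall>\<^sub>F t in sequentially. a - 1 / 2 ^ s < real (k t) / 2 ^ t"
      using dyadic_limitD(3)[OF k] by (intro order_tendstoD(1)[of _ a]) auto
    ultimately have "\<forall>\<^sub>F t in sequentially. a - 1 / 2 ^ s < real (l t) / 2 ^ t \<and>
        a - 1 / 2 ^ s < real (k t) / 2 ^ t"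
      by (rule eventually_conj)
    then obtain t where "a - 1 / 2 ^ s < real (l t) / 2 ^ t" "a - 1 / 2 ^ s < real (k t) / 2 ^ t"
      using eventually_happens'[OF sequentially_bot] by blast
    then have "real (k s) / 2 ^ s < real (l t) / 2 ^ t + 1 / 2 ^ s \<and>
        real (l s) / 2 ^ s < real (k t) / 2 ^ t + 1 / 2 ^ s"
      using dyadic_limit_ge[OF k, of s] dyadic_limit_ge[OF l, of s] eq by linarith
    then show "\<exists>t. k s * 2 ^ t < l t * 2 ^ s + 2 ^ t \<and> l s * 2 ^ t < k t * 2 ^ s + 2 ^ t"
      unfolding dyadic_less_iff by blast
  qed
next
  assume R: ?R
  have le: "real (k s) / 2 ^ s \<le> b + 1 / 2 ^ s \<and> real (l s) / 2 ^ s \<le> a + 1 / 2 ^ s" for s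
  proof -
    from R obtain t where "real (k s) / 2 ^ s < real (l t) / 2 ^ t + 1 / 2 ^ s"
      "real (l s) / 2 ^ s < real (k t) / 2 ^ t + 1 / 2 ^ s"
      unfolding dyadic_less_iff by blast
    then show ?thesis using dyadic_limit_ge[OF k, of t] dyadic_limit_ge[OF l, of t] by linarith
  qed
  have "a \<le> b" using k by (rule dyadic_limit_le) (use le in blast)
  moreover have "b \<le> a" using l by (rule dyadic_limit_le) (use le in blast)
  ultimately show "a = b" by simp
qed

lemma Sigma3_of_numbering:
  assumes "left_re_numbering \<alpha>" "left_re_numbering_of \<beta> C"
  shows "Sigma3_set {e. \<alpha> e \<in> C}"
proof -
  obtain K where K: "dyadic_approx K \<alpha>" using assms(1) by (rule dyadic_approx_of_numbering)
  obtain L where L: "dyadic_approx L \<beta>" and C: "range \<beta> = C"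
    using assms(2) dyadic_approx_of_numbering unfolding left_re_numbering_of_def by blast
  define S where "S e i b c \<longleftrightarrow> K e b * 2 ^ c < L i c * 2 ^ b + 2 ^ c \<and> L i b * 2 ^ c < K e c * 2 ^ b + 2 ^ c"
    for e i b c
  define R where "R xs \<longleftrightarrow> S (xs ! 0) (xs ! 1) (xs ! 2) (xs ! 3)" for xs
  have cK: "computable (\<lambda>p. K (fst p) (snd p))" and cL: "computable (\<lambda>p. L (fst p) (snd p))"
    using K L by (auto simp: dyadic_approx_def)
  have R_eq: "R [e, i, b, c] \<longleftrightarrow> S e i b c" for e i b c
    by (simp add: R_def numeral_3_eq_3 numeral_2_eq_2)
  have "recursive_pred 4 R"
    unfolding recursive_pred_4_iff R_eq S_def
    by (intro computable_intros computable_comp2[OF cK] computable_comp2[OF cL])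
  moreover have "\<alpha> e = \<beta> i \<longleftrightarrow> (\<forall>b. \<exists>c. R [e, i, b, c])" for e i
    unfolding R_eq S_def using K L by (intro dyadic_limit_eq_iff) (auto simp: dyadic_approx_def)
  then have "{e. \<alpha> e \<in> C} = {e. \<exists>i. \<forall>b. \<exists>c. R [e, i, b, c]}"
    using C by (metis rangeE rangeI)
  ultimately show ?thesis unfolding Sigma3_set_def by blast
qed

section \<open>Following a left-r.e. real while staying a shift of X\<close>

text \<open>In the state \<open>(k, n, b)\<close> the constructed real is \<open>k\<close>, written with \<open>n\<close> binary digits, followed
  by \<open>X\<close>, and the first \<open>b\<close> instances of the \<open>\<Pi>\<^sub>2\<close> condition \<open>\<forall>b. \<exists>s. Q b s\<close> have been verified.
  The next approximation of the followed real is adopted only if it exceeds everything that starts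
  with \<open>k\<close>, and diminished by one unit so that there is room for \<open>X\<close> again.\<close>

definition follow_state :: "(nat \<Rightarrow> nat) \<Rightarrow> (nat \<Rightarrow> nat \<Rightarrow> bool) \<Rightarrow> nat \<Rightarrow> nat \<Rightarrow> nat \<times> nat \<times> nat" where
  "follow_state y Q m s = rec_nat (0, m, 0)
     (\<lambda>s v. if fst (snd v) \<le> s \<and> (fst v + 1) * 2 ^ (Suc s - fst (snd v)) < y (Suc s) \<and> Q (snd (snd v)) s
            then (y (Suc s) - 1, Suc s, Suc (snd (snd v))) else v) s"

text \<open>Approximates \<open>(k + X) / 2 ^ n\<close>. Before stage n the truncated difference
  leaves \<open>k + x 0\<close>, which is 0 for \<open>k = 0\<close> and \<open>X < 1\<close>; hence
  the side condition \<open>k = 0 \<or> n \<le> s\<close> below.\<close>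

definition shifted :: "(nat \<Rightarrow> nat) \<Rightarrow> nat \<Rightarrow> nat \<Rightarrow> nat \<Rightarrow> nat" where
  "shifted x k n s = k * 2 ^ (s - n) + x (s - n)"

definition follow :: "(nat \<Rightarrow> nat) \<Rightarrow> (nat \<Rightarrow> nat) \<Rightarrow> (nat \<Rightarrow> nat \<Rightarrow> bool) \<Rightarrow> nat \<Rightarrow> nat \<Rightarrow> nat" where
  "follow x y Q m s = shifted x (fst (follow_state y Q m s)) (fst (snd (follow_state y Q m s))) s"

lemma dyadic_limit_0: "dyadic_limit x X \<Longrightarrow> X < 1 \<Longrightarrow> x 0 = 0"
  using dyadic_limit_less_pow[of x X 0] by simp

lemma shifted_step:
  assumes x: "dyadic_limit x X" "X < 1" and "k = 0 \<or> n \<le> s"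
  shows "2 * shifted x k n s \<le> shifted x k n (Suc s)"
proof (cases "n \<le> s")
  case True
  then show ?thesis
    using dyadic_limitD(2)[OF x(1), of "s - n"] by (simp add: shifted_def Suc_diff_le algebra_simps)
next
  case False
  then show ?thesis using assms(3) dyadic_limit_0[OF x] by (simp add: shifted_def)
qed

lemma shifted_le:
  assumes "dyadic_limit x X"
  shows "shifted x k n s \<le> (k + 1) * 2 ^ (s - n)"
  using dyadic_limitD(1)[OF assms, of "s - n"] by (simp add: shifted_def)

lemma shifted_le_pow:
  assumes x: "dyadic_limit x X" "X < 1" and "k = 0 \<or> n \<le> s" "k < 2 ^ n"
  shows "shifted x k n s \<le> 2 ^ s"
proof (cases "n \<le> s")
  case True
  have "shifted x k n s \<le> (k + 1) * 2 ^ (s - n)" using x(1) by (rule shifted_le)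
  also have "\<dots> \<le> 2 ^ n * 2 ^ (s - n)" using assms(4) by (intro mult_right_mono) auto
  also have "\<dots> = 2 ^ s" using True by (simp flip: power_add)
  finally show ?thesis .
next
  case False
  then show ?thesis using assms(3) dyadic_limit_0[OF x] by (simp add: shifted_def)
qed

lemma shifted_tendsto:
  assumes "dyadic_limit x X"
  shows "(\<lambda>s. real (shifted x k n s) / 2 ^ s) \<longlonglongrightarrow> (real k + X) / 2 ^ n"
proof (rule LIMSEQ_offset[of _ n])
  have "(\<lambda>s. (real k + real (x s) / 2 ^ s) / 2 ^ n) \<longlonglongrightarrow> (real k + X) / 2 ^ n"
    using dyadic_limitD(3)[OF assms] by (intro tendsto_intros) auto
  moreover have "real (shifted x k n (s + n)) / 2 ^ (s + n) = (real k + real (x s) / 2 ^ s) / 2 ^ n" for s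
    by (simp add: shifted_def power_add field_simps)
  ultimately show "(\<lambda>s. real (shifted x k n (s + n)) / 2 ^ (s + n)) \<longlonglongrightarrow> (real k + X) / 2 ^ n"
    by simp
qed

text \<open>If the state changes finitely often, the last k and n give a shift of X. If it changes
  infinitely often, each change brings the value within one unit of y and verifies one more instance
  of Q, so the limit is A. A change needs y to exceed \<open>(k + 1) / 2 ^ n\<close>: initially this
  is \<open>1 / 2 ^ m\<close>, later it is at most A, and a non-dyadic A cannot equal it.\<close>

lemma follow_correct:
  fixes x y :: "nat \<Rightarrow> nat"
  assumes x: "dyadic_limit x X" "X < 1" and y: "dyadic_limit y A"
    and Q: "\<And>b s t. s \<le> t \<Longrightarrow> Q b s \<Longrightarrow> Q b t"
  obtains z where "dyadic_limit (follow x y Q m) z"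
    "(\<exists>k n. k < 2 ^ n \<and> z = (real k + X) / 2 ^ n) \<or> z = A \<and> (\<forall>b. \<exists>s. Q b s)"
    "(\<forall>k n. A \<noteq> real k / 2 ^ n) \<and> 1 / 2 ^ m < A \<and> (\<forall>b. \<exists>s. Q b s) \<longrightarrow> z = A"
proof -
  let ?st = "follow_state y Q m"
  define k where "k s = fst (?st s)" for s
  define n where "n s = fst (snd (?st s))" for s
  define b where "b s = snd (snd (?st s))" for s
  define L where "L = follow x y Q m"
  define adv where "adv s \<longleftrightarrow> n s \<le> s \<and> (k s + 1) * 2 ^ (Suc s - n s) < y (Suc s) \<and> Q (b s) s" for s
  have init: "k 0 = 0" "n 0 = m" "b 0 = 0"
    by (simp_all add: k_def n_def b_def follow_state_def)
  have "?st (Suc s) = (if adv s then (y (Suc s) - 1, Suc s, Suc (b s)) else ?st s)" for s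
    unfolding adv_def k_def n_def b_def by (simp add: follow_state_def)
  then have step: "adv s \<Longrightarrow> k (Suc s) = y (Suc s) - 1" "adv s \<Longrightarrow> n (Suc s) = Suc s"
    "adv s \<Longrightarrow> b (Suc s) = Suc (b s)" "\<not> adv s \<Longrightarrow> k (Suc s) = k s"
    "\<not> adv s \<Longrightarrow> n (Suc s) = n s" "\<not> adv s \<Longrightarrow> b (Suc s) = b s" for s
    by (auto simp: k_def n_def b_def)
  have L_eq: "L s = shifted x (k s) (n s) s" for s
    by (simp add: L_def follow_def k_def n_def)
  \<comment> \<open>After a change, n is the stage whose approximation was adopted and k is one less
    than that approximation. This yields both k < \<open>2 ^ n\<close> and
    \<open>(k + 1) / 2 ^ n \<le> A\<close>.\<close>
  have inv: "k s = 0 \<and> n s = m \<or> n s \<le> s \<and> k s + 1 \<le> y (n s)" for s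
  proof (induction s)
    case 0
    show ?case by (simp add: init)
  next
    case (Suc s)
    show ?case
    proof (cases "adv s")
      case True
      then have "0 < y (Suc s)" by (auto simp: adv_def)
      then show ?thesis by (simp add: step True)
    next
      case False
      then show ?thesis using Suc by (auto simp: step)
    qed
  qed
  have k_less: "k s < 2 ^ n s" for s
    using inv[of s] dyadic_limitD(1)[OF y, of "n s"] by auto
  have ready: "k s = 0 \<or> n s \<le> s" for s using inv[of s] by auto
  have adv_value: "L (Suc s) = y (Suc s) - 1" if "adv s" for s
    using that by (simp add: L_eq step shifted_def dyadic_limit_0[OF x])
  have L_step: "2 * L s \<le> L (Suc s)" for s
  proof (cases "adv s")
    case True
    then have "n s \<le> s" by (simp add: adv_def)
    have "2 * L s \<le> 2 * ((k s + 1) * 2 ^ (s - n s))"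
      unfolding L_eq using shifted_le[OF x(1)] by (intro mult_left_mono) auto
    also have "\<dots> = (k s + 1) * 2 ^ (Suc s - n s)" using \<open>n s \<le> s\<close> by (simp add: Suc_diff_le)
    \<comment> \<open>Strictness in the condition for a change pays for the unit that is
      subtracted.\<close>
    also have "\<dots> \<le> y (Suc s) - 1" using True by (auto simp: adv_def)
    also have "\<dots> = L (Suc s)" using True by (simp add: adv_value)
    finally show ?thesis .
  next
    case False
    then show ?thesis unfolding L_eq by (simp add: step shifted_step[OF x ready])
  qed
  have L_le: "L s \<le> 2 ^ s" for s
    unfolding L_eq by (rule shifted_le_pow[OF x ready k_less])
  have "real (L s) / 2 ^ s \<le> 1" for s using L_le[of s] by (simp flip: of_nat_le_iff)
  then obtain z where "(\<lambda>s. real (L s) / 2 ^ s) \<longlonglongrightarrow> z"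
    using incseq_convergent[OF incseq_dyadic[of L, OF L_step], of 1] by blast
  then have z: "dyadic_limit L z" using L_step L_le by (simp add: dyadic_limit_def)
  have stuck: "k s = k s0 \<and> n s = n s0 \<and> b s = b s0" if "\<forall>s\<ge>s0. \<not> adv s" "s0 \<le> s" for s s0
    using that(2,1) by (induction rule: dec_induct) (auto simp: step)
  have stuck_limit: "z = (real (k s0) + X) / 2 ^ n s0" if "\<forall>s\<ge>s0. \<not> adv s" for s0
  proof (rule LIMSEQ_unique[OF dyadic_limitD(3)[OF z]])
    have "\<forall>\<^sub>F s in sequentially. real (shifted x (k s0) (n s0) s) / 2 ^ s = real (L s) / 2 ^ s"
    proof (rule eventually_sequentiallyI)
      fix s assume "s0 \<le> s"
      with stuck[OF that] have "k s = k s0" "n s = n s0" by blast+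
      then show "real (shifted x (k s0) (n s0) s) / 2 ^ s = real (L s) / 2 ^ s"
        by (simp only: L_eq)
    qed
    then show "(\<lambda>s. real (L s) / 2 ^ s) \<longlonglongrightarrow> (real (k s0) + X) / 2 ^ n s0"
      by (rule Lim_transform_eventually[OF shifted_tendsto[OF x(1)]])
  qed
  have progress: "z = A \<and> (\<forall>B. \<exists>s. Q B s)" if inf: "\<forall>s0. \<exists>s\<ge>s0. adv s"
  proof
    have close: "\<exists>t\<ge>s. real (L t) / 2 ^ t \<le> real (y t) / 2 ^ t \<and>
        real (y t) / 2 ^ t \<le> real (L t) / 2 ^ t + 1 / 2 ^ t" for s
    proof -
      obtain t where t: "s \<le> t" "adv t" using inf by blast
      have "real (L (Suc t)) \<le> real (y (Suc t))" "real (y (Suc t)) \<le> real (L (Suc t)) + 1"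
        using adv_value[OF t(2)] by linarith+
      then show ?thesis using t(1) by (intro exI[of _ "Suc t"]) (simp add: field_simps)
    qed
    have "A \<le> z"
      using y
    proof (rule dyadic_limit_le)
      fix s
      show "\<exists>t\<ge>s. real (y t) / 2 ^ t \<le> z + 1 / 2 ^ t"
        using close[of s] dyadic_limit_ge[OF z] by (meson add_right_mono order_trans)
    qed
    moreover have "z \<le> A"
      using z
    proof (rule dyadic_limit_le)
      fix s
      obtain t where "s \<le> t" "real (L t) / 2 ^ t \<le> real (y t) / 2 ^ t" using close by blast
      moreover have "real (y t) / 2 ^ t \<le> A" "0 \<le> (1 :: real) / 2 ^ t" for t
        using dyadic_limit_ge[OF y] by auto
      ultimately show "\<exists>t\<ge>s. real (L t) / 2 ^ t \<le> A + 1 / 2 ^ t"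
        by (intro exI[of _ t]) (smt (verit))
    qed
    ultimately show "z = A" by simp
    have b_mono: "mono b" by (rule mono_iff_le_Suc[THEN iffD2]) (metis le_Suc_eq order_refl step(3,6))
    have unbounded: "\<exists>s. B < b s" for B
    proof (induction B)
      case 0
      obtain s where "adv s" using inf by blast
      then show ?case using step(3) by (metis zero_less_Suc)
    next
      case (Suc B)
      then obtain s where s: "B < b s" by blast
      obtain t where t: "s \<le> t" "adv t" using inf by blast
      have "b s \<le> b t" using monoD[OF b_mono t(1)] .
      then show ?case using s step(3)[OF t(2)] by (intro exI[of _ "Suc t"]) simp
    qed
    show "\<forall>B. \<exists>s. Q B s"
    proof
      fix B
      \<comment> \<open>The counter rises by one at a time, so just before it first exceeds B it
        equals B, and the change made there has verified \<open>Q B\<close>.\<close>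
      define s where "s = (LEAST s. B < b s)"
      have s: "B < b s" unfolding s_def by (rule LeastI_ex[OF unbounded])
      with init obtain r where r: "s = Suc r" by (cases s) auto
      have "\<not> B < b r" by (rule not_less_Least) (simp add: r flip: s_def)
      with s r have "adv r" "b r = B" using step(3,6)[of r] by (cases "adv r"; simp)+
      then show "\<exists>s. Q B s" by (auto simp: adv_def)
    qed
  qed
  show ?thesis
  proof (rule that[of z])
    show "dyadic_limit (follow x y Q m) z" using z by (simp add: L_def)
    show "(\<exists>k n. k < 2 ^ n \<and> z = (real k + X) / 2 ^ n) \<or> z = A \<and> (\<forall>b. \<exists>s. Q b s)"
      using progress stuck_limit k_less by blast
    have "\<forall>s0. \<exists>s\<ge>s0. adv s"
      if nd: "\<forall>k n. A \<noteq> real k / 2 ^ n" and m: "1 / 2 ^ m < A" and all: "\<forall>b. \<exists>s. Q b s"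
    proof (rule ccontr)
      assume "\<not> ?thesis"
      then obtain s0 where s0: "\<forall>s\<ge>s0. \<not> adv s" by blast
      have "real (k s0 + 1) / 2 ^ n s0 \<le> A"
        using inv[of s0]
      proof
        assume *: "n s0 \<le> s0 \<and> k s0 + 1 \<le> y (n s0)"
        then have "real (k s0 + 1) / 2 ^ n s0 \<le> real (y (n s0)) / 2 ^ n s0"
          by (intro divide_right_mono) auto
        then show ?thesis using dyadic_limit_ge[OF y, of "n s0"] by linarith
      qed (use m in simp)
      \<comment> \<open>Non-dyadicity makes the inequality strict, so the approximations of A
        eventually pass the threshold, contrary to stalling.\<close>
      with nd have "real (k s0 + 1) / 2 ^ n s0 < A" by (metis order_le_less)
      then have ev: "\<forall>\<^sub>F s in sequentially. real (k s0 + 1) / 2 ^ n s0 < real (y s) / 2 ^ s"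
        using dyadic_limitD(3)[OF y] by (rule order_tendstoD(1)[rotated])
      obtain t where t: "Q (b s0) t" using all by blast
      obtain N where N: "\<And>s. N \<le> s \<Longrightarrow> real (k s0 + 1) / 2 ^ n s0 < real (y s) / 2 ^ s"
        using ev unfolding eventually_sequentially by blast
      define s where "s = s0 + t + N + n s0"
      have s: "k s = k s0" "n s = n s0" "b s = b s0"
        using stuck[OF s0, of s] by (auto simp: s_def)
      have pow: "(2::real) ^ Suc s = 2 ^ n s0 * 2 ^ (Suc s - n s0)"
        by (subst power_add[symmetric]) (simp add: s_def)
      have "real (k s0 + 1) / 2 ^ n s0 < real (y (Suc s)) / 2 ^ Suc s"
        by (rule N) (simp add: s_def)
      moreover have "real ((k s0 + 1) * 2 ^ (Suc s - n s0)) / 2 ^ Suc s = real (k s0 + 1) / 2 ^ n s0"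
        unfolding pow of_nat_mult of_nat_power of_nat_numeral by (rule mult_divide_mult_cancel_right) simp
      ultimately have "real ((k s0 + 1) * 2 ^ (Suc s - n s0)) / 2 ^ Suc s < real (y (Suc s)) / 2 ^ Suc s"
        by (simp only:)
      then have "real ((k s0 + 1) * 2 ^ (Suc s - n s0)) < real (y (Suc s))"
        by (subst (asm) divide_less_cancel) simp
      then have "(k s0 + 1) * 2 ^ (Suc s - n s0) < y (Suc s)" unfolding of_nat_less_iff .
      moreover have "Q (b s0) s" using t by (rule Q[rotated]) (simp add: s_def)
      moreover have "n s0 \<le> s" by (simp add: s_def)
      ultimately have "adv s" by (simp only: adv_def s simp_thms)
      moreover have "s0 \<le> s" by (simp add: s_def)
      ultimately show False using s0 by blast
    qed
    then show "(\<forall>k n. A \<noteq> real k / 2 ^ n) \<and> 1 / 2 ^ m < A \<and> (\<forall>b. \<exists>s. Q b s) \<longrightarrow> z = A"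
      using progress by blast
  qed
qed

text \<open>An index codes a triple (e, a, m): the real to follow, a candidate witness, and the
  number of zeros in front of X at the start. A false witness stalls and still gives a member of C;
  a member of C is positive, so a large m lets it be followed.\<close>

lemma numbering_of_Sigma3:
  assumes C: "\<forall>X\<in>C. left_re X \<and> infinite_real X" and X: "shift_persistent C X"
    and univ: "universal_left_re_numbering \<alpha>" and Sigma: "Sigma3_set {e. \<alpha> e \<in> C}"
  shows "\<exists>\<beta>. left_re_numbering_of \<beta> C"
proof -
  have \<alpha>: "left_re_numbering \<alpha>" and range: "range \<alpha> = {X. left_re X}"
    using univ by (auto simp: universal_left_re_numbering_def left_re_numbering_of_def)
  obtain K where K: "dyadic_approx K \<alpha>" using \<alpha> by (rule dyadic_approx_of_numbering)
  then have cK: "computable (\<lambda>p. K (fst p) (snd p))" and lim: "\<And>e. dyadic_limit (K e) (\<alpha> e)"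
    by (auto simp: dyadic_approx_def)
  have "X \<in> C" using X by (simp add: shift_persistent_def)
  then have "X < 1" and "X \<in> range \<alpha>" using C infinite_real_bounds range by auto
  \<comment> \<open>Universality gives X an index and thereby a computable approximation.\<close>
  then obtain e0 where e0: "X = \<alpha> e0" by blast
  define x where "x = K e0"
  have x: "dyadic_limit x X" using lim[of e0] by (simp add: x_def e0)
  have cx: "computable x"
    unfolding x_def by (intro computable_comp2[OF cK] computable_intros)
  obtain R where R: "recursive_pred 4 R" and set: "{e. \<alpha> e \<in> C} = {e. \<exists>a. \<forall>b. \<exists>c. R [e, a, b, c]}"
    using Sigma unfolding Sigma3_set_def by blast
  define R' where "R' e a b c \<longleftrightarrow> R [e, a, b, c]" for e a b c
  have cR: "computable (\<lambda>p. R' (fst p) (fst (snd p)) (fst (snd (snd p))) (snd (snd (snd p))))"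
    using R unfolding recursive_pred_4_iff R'_def .
  \<comment> \<open>Bounding the search for c by the stage makes the test decidable and monotone in
    s.\<close>
  define Q where "Q e a b s \<longleftrightarrow> (\<exists>c<s. R' e a b c)" for e a b s
  define ie where "ie j = fst (prod_decode j)" for j
  define ia where "ia j = fst (prod_decode (snd (prod_decode j)))" for j
  define im where "im j = snd (prod_decode (snd (prod_decode j)))" for j
  define L where "L j s = follow x (K (ie j)) (Q (ie j) (ia j)) (im j) s" for j s
  have R'_comp: "computable (\<lambda>z. R' (f z) (g z) (h z) (i z))"
    if "computable f" "computable g" "computable h" "computable i"
    for f g h i :: "'z::encodable \<Rightarrow> nat"
    using computable_comp[OF cR computable_Pair[OF that(1) computable_Pair[OF that(2) computable_Pair[OF that(3,4)]]]]
    by simp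
  have "computable (\<lambda>p. L (fst p) (snd p))"
    unfolding L_def follow_def shifted_def follow_state_def Q_def ie_def ia_def im_def
    by (intro computable_intros computable_comp2[OF cK] R'_comp computable_comp[OF cx])
  moreover have "\<exists>z. dyadic_limit (L j) z \<and> z \<in> C \<and>
      (\<alpha> (ie j) \<in> C \<longrightarrow> 1 / 2 ^ im j < \<alpha> (ie j) \<longrightarrow> (\<forall>b. \<exists>c. R' (ie j) (ia j) b c) \<longrightarrow> z = \<alpha> (ie j))" for j
  proof -
    have Q_mono: "Q e a b t" if "s \<le> t" "Q e a b s" for e a b s t
      using that unfolding Q_def by (meson less_le_trans)
    have Q_iff: "(\<exists>s. Q e a b s) \<longleftrightarrow> (\<exists>c. R' e a b c)" for e a b
      unfolding Q_def by blast
    obtain z where z: "dyadic_limit (L j) z"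
      "(\<exists>k n. k < 2 ^ n \<and> z = (real k + X) / 2 ^ n) \<or>
        z = \<alpha> (ie j) \<and> (\<forall>b. \<exists>s. Q (ie j) (ia j) b s)"
      "(\<forall>k n. \<alpha> (ie j) \<noteq> real k / 2 ^ n) \<and> 1 / 2 ^ im j < \<alpha> (ie j) \<and>
        (\<forall>b. \<exists>s. Q (ie j) (ia j) b s) \<longrightarrow> z = \<alpha> (ie j)"
      unfolding L_def
      by (rule follow_correct[where Q = "Q (ie j) (ia j)" and m = "im j",
            OF x \<open>X < 1\<close> lim[of "ie j"] Q_mono])
    have "z \<in> C"
      using z(2)
    proof
      assume "\<exists>k n. k < 2 ^ n \<and> z = (real k + X) / 2 ^ n"
      then show ?thesis using shift_persistent_dyadic_shift[OF X] by blast
    next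
      assume *: "z = \<alpha> (ie j) \<and> (\<forall>b. \<exists>s. Q (ie j) (ia j) b s)"
      then have "ie j \<in> {e. \<exists>a. \<forall>b. \<exists>c. R [e, a, b, c]}"
        unfolding Q_iff R'_def by blast
      then show ?thesis using * unfolding set[symmetric] by simp
    qed
    moreover have "z = \<alpha> (ie j)"
      if "\<alpha> (ie j) \<in> C" "1 / 2 ^ im j < \<alpha> (ie j)" "\<forall>b. \<exists>c. R' (ie j) (ia j) b c"
    proof (rule z(3)[THEN mp], intro conjI that(2))
      show "\<forall>k n. \<alpha> (ie j) \<noteq> real k / 2 ^ n"
        using that(1) C infinite_real_not_dyadic by blast
      show "\<forall>b. \<exists>s. Q (ie j) (ia j) b s" unfolding Q_iff by (rule that(3))
    qed
    ultimately show ?thesis using z(1) by blast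
  qed
  then obtain \<beta> where \<beta>: "\<And>j. dyadic_limit (L j) (\<beta> j)" "\<And>j. \<beta> j \<in> C"
    "\<And>j. \<alpha> (ie j) \<in> C \<Longrightarrow> 1 / 2 ^ im j < \<alpha> (ie j) \<Longrightarrow> \<forall>b. \<exists>c. R' (ie j) (ia j) b c \<Longrightarrow> \<beta> j = \<alpha> (ie j)"
    by metis
  ultimately have "dyadic_approx L \<beta>" by (simp add: dyadic_approx_def)
  then have "left_re_numbering \<beta>" by (rule numbering_of_dyadic_approx)
  moreover have "range \<beta> = C"
  proof
    show "range \<beta> \<subseteq> C" using \<beta>(2) by blast
    show "C \<subseteq> range \<beta>"
    proof
      fix z assume z: "z \<in> C"
      then obtain e where e: "z = \<alpha> e" using C range by blast
      then have "e \<in> {e. \<alpha> e \<in> C}" using z by simp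
      then obtain a where a: "\<forall>b. \<exists>c. R [e, a, b, c]" unfolding set by blast
      have "0 < z" using z C infinite_real_bounds(1) by blast
      then obtain m where "(1 / 2 :: real) ^ m < z" using real_arch_pow_inv[of z "1 / 2"] by auto
      then have m: "1 / 2 ^ m < \<alpha> e" by (simp add: e power_one_over)
      let ?j = "prod_encode (e, prod_encode (a, m))"
      have "\<beta> ?j = \<alpha> e"
        using \<beta>(3)[of ?j] a m z e by (simp add: ie_def ia_def im_def R'_def)
      then show "z \<in> range \<beta>" using e by (metis rangeI)
    qed
  qed
  ultimately show ?thesis unfolding left_re_numbering_of_def by blast
qed

section \<open>Friedberg numberings\<close>

text \<open>In truncated subtraction \<open>k - l + (l - k)\<close> is the distance of k and l; the
  test compares fractions over \<open>2 ^ s\<close> at precision \<open>1 / 2 ^ v\<close>.\<close>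

definition close :: "nat \<Rightarrow> nat \<Rightarrow> nat \<Rightarrow> nat \<Rightarrow> bool" where
  "close k l s v \<longleftrightarrow> (k - l + (l - k)) * 2 ^ v \<le> 2 ^ s"

lemma close_iff: "close k l s v \<longleftrightarrow> \<bar>real k / 2 ^ s - real l / 2 ^ s\<bar> \<le> 1 / 2 ^ v"
proof -
  have "\<bar>real k / 2 ^ s - real l / 2 ^ s\<bar> = real (k - l + (l - k)) / 2 ^ s"
    by (cases "k \<le> l") (simp_all add: of_nat_diff diff_divide_distrib[symmetric])
  then have "\<bar>real k / 2 ^ s - real l / 2 ^ s\<bar> \<le> 1 / 2 ^ v \<longleftrightarrow>
      real (k - l + (l - k)) * 2 ^ v \<le> 2 ^ s"
    by (simp add: field_simps)
  also have "\<dots> \<longleftrightarrow> real ((k - l + (l - k)) * 2 ^ v) \<le> real (2 ^ s)"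
    by (simp only: of_nat_mult of_nat_power of_nat_numeral)
  finally show ?thesis unfolding close_def of_nat_le_iff by simp
qed

lemma eventually_close:
  assumes "dyadic_limit k a" "dyadic_limit l a"
  shows "\<forall>\<^sub>F s in sequentially. close (k s) (l s) s v"
proof -
  have "(\<lambda>s. \<bar>real (k s) / 2 ^ s - real (l s) / 2 ^ s\<bar>) \<longlonglongrightarrow> \<bar>a - a\<bar>"
    using assms[THEN dyadic_limitD(3)] by (intro tendsto_intros)
  then have "\<forall>\<^sub>F s in sequentially. \<bar>real (k s) / 2 ^ s - real (l s) / 2 ^ s\<bar> < 1 / 2 ^ v"
    by (rule order_tendstoD(2)) simp
  then show ?thesis by eventually_elim (simp add: close_iff)
qed

lemma ex_pow2_less:
  assumes "0 < (d::real)"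
  obtains v where "\<And>w. v \<le> w \<Longrightarrow> 1 / 2 ^ w < d"
proof -
  obtain v where v: "(1 / 2 :: real) ^ v < d" using real_arch_pow_inv[OF assms, of "1 / 2"] by auto
  have "1 / 2 ^ w < d" if "v \<le> w" for w
  proof -
    have "(1::real) / 2 ^ w \<le> 1 / 2 ^ v" using that by (simp add: frac_le)
    with v show ?thesis by (simp add: power_one_over)
  qed
  then show ?thesis by (rule that)
qed

text \<open>All finer precisions w are treated at once, because the test will be applied with a
  precision that varies with the stage.\<close>

lemma eventually_not_close:
  assumes "dyadic_limit k a" "dyadic_limit l b" "a \<noteq> b"
  shows "\<exists>v. \<forall>\<^sub>F s in sequentially. \<forall>w\<ge>v. \<not> close (k s) (l s) s w"
proof -
  have "0 < \<bar>a - b\<bar> / 2" using assms(3) by simp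
  then obtain v where v: "\<And>w. v \<le> w \<Longrightarrow> 1 / 2 ^ w < \<bar>a - b\<bar> / 2"
    using ex_pow2_less by blast
  have "(\<lambda>s. \<bar>real (k s) / 2 ^ s - real (l s) / 2 ^ s\<bar>) \<longlonglongrightarrow> \<bar>a - b\<bar>"
    using assms(1,2)[THEN dyadic_limitD(3)] by (intro tendsto_intros)
  then have "\<forall>\<^sub>F s in sequentially. \<bar>a - b\<bar> / 2 < \<bar>real (k s) / 2 ^ s - real (l s) / 2 ^ s\<bar>"
    by (rule order_tendstoD(1)) (use assms(3) in simp)
  then have "\<forall>\<^sub>F s in sequentially. \<forall>w\<ge>v. \<not> close (k s) (l s) s w"
  proof eventually_elim
    case (elim s)
    show ?case unfolding close_iff using elim v by fastforce
  qed
  then show ?thesis by blast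
qed

lemma eventually_not_close_finite:
  fixes N :: nat
  assumes "\<And>i. i < N \<Longrightarrow> dyadic_limit (k i) (a i)" "dyadic_limit l b" "\<And>i. i < N \<Longrightarrow> a i \<noteq> b"
  shows "\<exists>v. \<forall>\<^sub>F s in sequentially. \<forall>i<N. \<forall>w\<ge>v. \<not> close (k i s) (l s) s w"
  using assms(1,3)
proof (induction N)
  case 0
  show ?case by simp
next
  case (Suc N)
  obtain v where v: "\<forall>\<^sub>F s in sequentially. \<forall>i<N. \<forall>w\<ge>v. \<not> close (k i s) (l s) s w"
    using Suc by auto
  obtain u where u: "\<forall>\<^sub>F s in sequentially. \<forall>w\<ge>u. \<not> close (k N s) (l s) s w"
    using eventually_not_close[OF Suc.prems(1) assms(2) Suc.prems(2), of N] by auto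
  have "\<forall>\<^sub>F s in sequentially. \<forall>i<Suc N. \<forall>w\<ge>max u v. \<not> close (k i s) (l s) s w"
    using u v by eventually_elim (auto simp: less_Suc_eq)
  then show ?case by blast
qed

text \<open>Only the passage from t to t + 1 mixes the two sequences. It will replace the
  approximation of a dropped follower by that of a tail.\<close>

lemma dyadic_limit_switch:
  assumes "dyadic_limit k a" "dyadic_limit l b" "2 * k t \<le> l (Suc t)"
  shows "dyadic_limit (\<lambda>u. if u \<le> t then k u else l u) b"
  unfolding dyadic_limit_def
proof (intro conjI allI)
  show "(if s \<le> t then k s else l s) \<le> 2 ^ s" for s
    using dyadic_limitD(1)[OF assms(1)] dyadic_limitD(1)[OF assms(2)] by simp
  show "2 * (if s \<le> t then k s else l s) \<le> (if Suc s \<le> t then k (Suc s) else l (Suc s))" for s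
  proof (cases "s = t")
    case True
    then show ?thesis using assms(3) by simp
  next
    case False
    then show ?thesis
      using dyadic_limitD(2)[OF assms(1), of s] dyadic_limitD(2)[OF assms(2), of s] by auto
  qed
  have "\<forall>\<^sub>F s in sequentially. real (l s) / 2 ^ s = real (if s \<le> t then k s else l s) / 2 ^ s"
    by (rule eventually_sequentiallyI[of "Suc t"]) simp
  then show "(\<lambda>s. real (if s \<le> t then k s else l s) / 2 ^ s) \<longlonglongrightarrow> b"
    by (rule Lim_transform_eventually[OF dyadic_limitD(3)[OF assms(2)]])
qed

lemma computable_enumerate:
  fixes S :: "nat set"
  assumes "computable (\<lambda>y. y \<in> S)" "infinite S"
  shows "computable (enumerate S)"
proof -
  have "enumerate S n = rec_nat (LEAST y. y \<in> S) (\<lambda>_ v. LEAST y. y \<in> S \<and> v < y) n" for n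
    by (induction n) (simp_all add: enumerate_0 enumerate_Suc''[OF assms(2)])
  moreover have "\<exists>y. y \<in> S \<and> v < y" for v
    using assms(2) by (meson infinite_nat_iff_unbounded)
  then have "computable (\<lambda>n. rec_nat (LEAST y. y \<in> S) (\<lambda>_ v. LEAST y. y \<in> S \<and> v < y) n)"
    by (intro computable_intros computable_comp[OF assms(1)]) auto
  ultimately show ?thesis by (simp add: computable_cong)
qed

section \<open>Guessing which reals are new\<close>

locale Friedberg_construction =
  fixes \<beta> :: "nat \<Rightarrow> real" and L :: "nat \<Rightarrow> nat \<Rightarrow> nat" and x :: "nat \<Rightarrow> nat" and X :: real
  assumes L: "dyadic_approx L \<beta>" and less_1: "\<beta> e < 1"
    and x: "dyadic_limit x X" and X_less_1: "X < 1" and computable_x: "computable x"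
begin

lemma computable_L: "computable (\<lambda>p. L (fst p) (snd p))" and limit_L: "dyadic_limit (L e) (\<beta> e)"
  using L by (auto simp: dyadic_approx_def)

text \<open>\<open>tail_val n\<close> is the number denoted by \<open>1\<^sup>n \<frown> X\<close>, and \<open>tail n\<close> approximates it; for \<open>s < n\<close>
  the truncated \<open>s - n = 0\<close> gives \<open>2 ^ s - 1\<close>, since \<open>x 0 = 0\<close>.\<close>

definition tail :: "nat \<Rightarrow> nat \<Rightarrow> nat" where
  "tail n s = 2 ^ s - 2 ^ (s - n) + x (s - n)"

definition tail_val :: "nat \<Rightarrow> real" where
  "tail_val n = 1 - (1 - X) / 2 ^ n"

lemma tail_ge: "2 ^ s - 2 ^ (s - n) \<le> tail n s"
  by (simp add: tail_def)

lemma limit_tail: "dyadic_limit (tail n) (tail_val n)"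
  unfolding dyadic_limit_def
proof (intro conjI allI)
  have pow: "(2::nat) ^ (s - n) \<le> 2 ^ s" for s by (rule power_increasing) auto
  show "tail n s \<le> 2 ^ s" for s
    using pow[of s] dyadic_limitD(1)[OF x, of "s - n"] by (simp add: tail_def)
  show "2 * tail n s \<le> tail n (Suc s)" for s
  proof (cases "n \<le> s")
    case True
    then show ?thesis
      using pow[of s] dyadic_limitD(2)[OF x, of "s - n"] by (simp add: tail_def Suc_diff_le)
  next
    case False
    then show ?thesis using dyadic_limit_0[OF x X_less_1] by (simp add: tail_def)
  qed
  show "(\<lambda>s. real (tail n s) / 2 ^ s) \<longlonglongrightarrow> tail_val n"
  proof (rule LIMSEQ_offset[of _ n])
    have "(\<lambda>s. 1 - (1 - real (x s) / 2 ^ s) / 2 ^ n) \<longlonglongrightarrow> tail_val n"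
      unfolding tail_val_def using dyadic_limitD(3)[OF x] by (intro tendsto_intros) auto
    moreover have "real (tail n (s + n)) / 2 ^ (s + n) = 1 - (1 - real (x s) / 2 ^ s) / 2 ^ n" for s
    proof -
      have "real (tail n (s + n)) = 2 ^ (s + n) - 2 ^ s + real (x s)"
        unfolding tail_def of_nat_add of_nat_diff[OF pow] by simp
      then show ?thesis by (simp add: power_add field_simps)
    qed
    ultimately show "(\<lambda>s. real (tail n (s + n)) / 2 ^ (s + n)) \<longlonglongrightarrow> tail_val n" by simp
  qed
qed

lemma inj_tail_val: "tail_val m = tail_val n \<longleftrightarrow> m = n"
  using X_less_1 by (auto simp: tail_val_def)

lemma computable_tail: "computable (\<lambda>p. tail (fst p) (snd p))"
  unfolding tail_def by (intro computable_intros computable_comp[OF computable_x])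

text \<open>\<open>count e\<close> grows whenever \<open>\<beta> e\<close> looks equal, to a precision that increases with the count, to a
  \<open>\<beta> i\<close> with \<open>i < e\<close> or to a \<open>1\<^sup>n \<frown> X\<close>.  As these tend to \<open>1\<close> while \<open>\<beta> e < 1\<close>, infinitely many \<open>n\<close>
  cannot conspire to drive the count to infinity.\<close>

definition near :: "nat \<Rightarrow> nat \<Rightarrow> nat \<Rightarrow> bool" where
  "near e s v \<longleftrightarrow> (\<exists>i<e. close (L i s) (L e s) s v) \<or> (\<exists>n<Suc s. close (tail n s) (L e s) s v)"

definition count :: "nat \<Rightarrow> nat \<Rightarrow> nat" where
  "count e s = rec_nat 0 (\<lambda>s v. if near e s v then Suc v else v) s"

lemma count_0: "count e 0 = 0"
  and count_Suc: "count e (Suc s) = (if near e s (count e s) then Suc (count e s) else count e s)"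
  by (simp_all add: count_def)

lemma computable_count: "computable (\<lambda>p. count (fst p) (snd p))"
  unfolding count_def near_def close_def
  by (intro computable_intros computable_comp2[OF computable_L] computable_comp2[OF computable_tail])

lemma count_mono: "s \<le> t \<Longrightarrow> count e s \<le> count e t"
  by (rule lift_Suc_mono_le[of "count e"]) (auto simp: count_Suc)

definition stable :: "nat \<Rightarrow> bool" where
  "stable e \<longleftrightarrow> (\<exists>s. \<forall>t. count e t \<le> count e s)"

text \<open>Once the count rests at v, closeness at precision v never recurs, whereas approximations
  of equal reals are eventually close at every precision.\<close>

lemma stable_distinct:
  assumes "stable e"
  shows "i < e \<Longrightarrow> \<beta> i \<noteq> \<beta> e" and "\<beta> e \<noteq> tail_val n"
proof -
  from assms obtain s where s: "\<And>t. count e t \<le> count e s" unfolding stable_def by blast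
  let ?v = "count e s"
  have not_near: "\<not> near e t ?v" if "s \<le> t" for t
  proof -
    have "count e t = ?v" using s[of t] count_mono[OF that] by (rule antisym)
    then show ?thesis using s[of "Suc t"] by (auto simp: count_Suc split: if_splits)
  qed
  show "\<beta> i \<noteq> \<beta> e" if "i < e"
  proof
    assume "\<beta> i = \<beta> e"
    then have "\<forall>\<^sub>F t in sequentially. close (L i t) (L e t) t ?v"
      using eventually_close[OF limit_L[of i]] limit_L[of e] by simp
    then obtain N where N: "\<And>t. N \<le> t \<Longrightarrow> close (L i t) (L e t) t ?v"
      unfolding eventually_sequentially by blast
    show False
      using not_near[of "max N s"] N[of "max N s"] that by (auto simp: near_def)
  qed
  show "\<beta> e \<noteq> tail_val n"
  proof
    assume "\<beta> e = tail_val n"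
    then have "\<forall>\<^sub>F t in sequentially. close (tail n t) (L e t) t ?v"
      using eventually_close[OF limit_tail[of n]] limit_L[of e] by simp
    then obtain N where N: "\<And>t. N \<le> t \<Longrightarrow> close (tail n t) (L e t) t ?v"
      unfolding eventually_sequentially by blast
    \<comment> \<open>The stage is taken at least n, so that n is among the tails tested by
      \<open>near\<close>.\<close>
    show False
      using not_near[of "max N (max n s)"] N[of "max N (max n s)"]
      by (auto simp: near_def less_Suc_eq_le)
  qed
qed

text \<open>From stage n on, the approximation of tail n is at least \<open>1 - 1 / 2 ^ n\<close>,
  out of reach of \<open>\<beta> e\<close> for large n. The finitely many other tails have limits
  different from \<open>\<beta> e\<close>.\<close>

lemma eventually_not_near_tail:
  assumes "\<And>n. \<beta> e \<noteq> tail_val n"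
  shows "\<exists>v. \<forall>\<^sub>F s in sequentially. \<forall>n<Suc s. \<forall>w\<ge>v. \<not> close (tail n s) (L e s) s w"
proof -
  \<comment> \<open>Half of the gap to 1 absorbs \<open>1 / 2 ^ n\<close>; the other half exceeds
    the precision \<open>1 / 2 ^ w\<close>.\<close>
  let ?d = "(1 - \<beta> e) / 2"
  have "0 < ?d" using less_1[of e] by simp
  then obtain N where N: "\<And>w. N \<le> w \<Longrightarrow> 1 / 2 ^ w < ?d" using ex_pow2_less by blast
  have large: "\<not> close (tail n s) (L e s) s w" if "N \<le> n" "n \<le> s" "N \<le> w" for n s w
  proof -
    have "(2::nat) ^ (s - n) \<le> 2 ^ s" by (rule power_increasing) auto
    then have "real (2 ^ s) - real (2 ^ (s - n)) \<le> real (tail n s)"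
      using tail_ge[of s n] by (simp only: of_nat_diff[symmetric] of_nat_le_iff)
    then have "(2 ^ s - 2 ^ (s - n)) / 2 ^ s \<le> real (tail n s) / 2 ^ s"
      by (intro divide_right_mono) auto
    moreover have "(2 ^ s - 2 ^ (s - n)) / 2 ^ s = 1 - 1 / (2::real) ^ n"
      using that(2) by (simp add: diff_divide_distrib power_diff)
    ultimately have "1 - ?d < real (tail n s) / 2 ^ s" using N[OF that(1)] by linarith
    then have "?d < real (tail n s) / 2 ^ s - real (L e s) / 2 ^ s"
      using dyadic_limit_ge[OF limit_L, of e s] by (simp add: field_simps)
    then show ?thesis unfolding close_iff using N[OF that(3)] by linarith
  qed
  have "tail_val n \<noteq> \<beta> e" for n using assms[of n] by simp
  then obtain v where v: "\<forall>\<^sub>F s in sequentially. \<forall>n<N. \<forall>w\<ge>v. \<not> close (tail n s) (L e s) s w"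
    using eventually_not_close_finite[of N tail tail_val "L e" "\<beta> e"] limit_tail limit_L by blast
  have "\<forall>\<^sub>F s in sequentially. \<forall>n<Suc s. \<forall>w\<ge>max v N. \<not> close (tail n s) (L e s) s w"
    using v
  proof eventually_elim
    case (elim s)
    show ?case
    proof (intro allI impI)
      fix n w assume "n < Suc s" "max v N \<le> w"
      then show "\<not> close (tail n s) (L e s) s w"
        using elim large[of n s w] by (cases "n < N") auto
    qed
  qed
  then show ?thesis by blast
qed

text \<open>An unbounded count would eventually exceed the precision from which closeness fails at
  all late stages; but then it could not grow any more.\<close>

lemma stableI:
  assumes "\<And>i. i < e \<Longrightarrow> \<beta> i \<noteq> \<beta> e" "\<And>n. \<beta> e \<noteq> tail_val n"
  shows "stable e"
proof (rule ccontr)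
  assume "\<not> stable e"
  then have inc: "\<exists>t. count e s < count e t" for s unfolding stable_def by (meson not_le)
  have unbounded: "\<exists>s. v \<le> count e s" for v
  proof (induction v)
    case (Suc v)
    then obtain s where "v \<le> count e s" by blast
    then show ?case using inc[of s] by (meson Suc_leI le_less_trans)
  qed simp
  obtain u where u: "\<forall>\<^sub>F s in sequentially. \<forall>i<e. \<forall>w\<ge>u. \<not> close (L i s) (L e s) s w"
    using eventually_not_close_finite[of e L \<beta> "L e" "\<beta> e"] limit_L assms(1) by blast
  obtain v where v: "\<forall>\<^sub>F s in sequentially. \<forall>n<Suc s. \<forall>w\<ge>v. \<not> close (tail n s) (L e s) s w"
    using eventually_not_near_tail assms(2) by blast
  have "\<forall>\<^sub>F s in sequentially. \<forall>w\<ge>max u v. \<not> near e s w"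
    using u v by eventually_elim (auto simp: near_def)
  then obtain N where N: "\<And>s w. N \<le> s \<Longrightarrow> max u v \<le> w \<Longrightarrow> \<not> near e s w"
    unfolding eventually_sequentially by blast
  obtain s where s: "max u v \<le> count e s" using unbounded by blast
  define s' where "s' = max s N"
  have s': "max u v \<le> count e s'" using s count_mono[of s s' e] by (simp add: s'_def)
  have const: "count e t = count e s'" if "s' \<le> t" for t
    using that
  proof (induction rule: dec_induct)
    case (step t)
    have "N \<le> t" using step.hyps(1) by (simp add: s'_def)
    then show ?case using N[of t "count e t"] s' step.IH by (simp add: count_Suc)
  qed simp
  obtain t where t: "count e s' < count e t" using inc by blast
  then have "s' \<le> t" using count_mono[of t s' e] by (meson leI less_imp_le_nat not_le)
  with t const[of t] show False by simp
qed

section \<open>Followers and the tails they turn into\<close>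

text \<open>A follower of \<open>\<beta> e\<close> is appointed at each stage \<open>s\<close> at which the count changes, and dropped at
  the next such stage \<open>t + 1\<close>, when it turns into \<open>1\<^sup>n \<frown> X\<close> for a number \<open>n \<ge> t\<close> coding \<open>(e, s, t)\<close>.\<close>

definition appointed :: "nat \<Rightarrow> nat \<Rightarrow> bool" where
  "appointed e s \<longleftrightarrow> s = 0 \<or> count e (s - 1) < count e s"

definition dropped :: "nat \<Rightarrow> nat \<Rightarrow> nat \<Rightarrow> bool" where
  "dropped e s t \<longleftrightarrow> count e s < count e (Suc t) \<and> count e t \<le> count e s"

definition code :: "nat \<Rightarrow> nat \<Rightarrow> nat \<Rightarrow> nat" where
  "code e s t = prod_encode (e, prod_encode (s, t))"

text \<open>Decoding n names the only follower that can turn into \<open>tail_val n\<close>, and its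
  fate is read off from finitely many counts; thus the property is decidable.\<close>

definition used :: "nat \<Rightarrow> bool" where
  "used n \<longleftrightarrow> (let e = fst (prod_decode n); s = fst (prod_decode (snd (prod_decode n)));
     t = snd (prod_decode (snd (prod_decode n))) in appointed e s \<and> dropped e s t)"

lemma used_iff: "used n \<longleftrightarrow> (\<exists>e s t. n = code e s t \<and> appointed e s \<and> dropped e s t)"
proof
  assume "used n"
  then show "\<exists>e s t. n = code e s t \<and> appointed e s \<and> dropped e s t"
    unfolding used_def Let_def code_def by (metis prod.collapse prod_decode_inverse)
qed (auto simp: used_def code_def)

lemma le_code: "t \<le> code e s t"
  unfolding code_def by (meson le_prod_encode_2 order_trans)

lemma code_inject: "code e s t = code e' s' t' \<longleftrightarrow> e = e' \<and> s = s' \<and> t = t'"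
  by (simp add: code_def)

lemma dropped_unique: "dropped e s t \<Longrightarrow> dropped e s t' \<Longrightarrow> t = t'"
proof (induction t t' rule: linorder_wlog)
  case (le t t')
  show ?case
  proof (rule ccontr)
    assume "t \<noteq> t'"
    then have "Suc t \<le> t'" using le(1) by simp
    from count_mono[OF this, of e] le show False by (simp add: dropped_def)
  qed
qed auto

text \<open>The disjunct \<open>u \<le> t\<close> keeps the search total and hence computable. It
  does not affect the result here, as a count that has risen by stage u did so at a step before
  u.\<close>

lemma dropped_of_less:
  assumes "count e s < count e u"
  shows "dropped e s (LEAST t. count e s < count e (Suc t) \<or> u \<le> t)"
    "(LEAST t. count e s < count e (Suc t) \<or> u \<le> t) < u"
proof -
  let ?P = "\<lambda>t. count e s < count e (Suc t) \<or> u \<le> t"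
  let ?t = "LEAST t. ?P t"
  obtain r where r: "u = Suc r" using assms count_0[of e] by (cases u) auto
  then have "?P r" using assms by simp
  then have "?t \<le> r" by (rule Least_le)
  then show "?t < u" using r by simp
  have "?P ?t" using \<open>?P r\<close> by (rule LeastI)
  then have less: "count e s < count e (Suc ?t)" using \<open>?t < u\<close> by simp
  have "count e ?t \<le> count e s"
  proof (cases ?t)
    case 0
    then show ?thesis by (simp add: count_0)
  next
    case (Suc t')
    then have "\<not> ?P t'" using not_less_Least[of t' ?P] by simp
    then show ?thesis using Suc by simp
  qed
  with less show "dropped e s ?t" by (simp add: dropped_def)
qed

lemma dropped_less_iff:
  assumes "dropped e s t"
  shows "count e s < count e u \<longleftrightarrow> t < u"
proof
  assume "t < u"
  then show "count e s < count e u"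
    using count_mono[of "Suc t" u e] assms by (simp add: dropped_def)
next
  assume *: "count e s < count e u"
  show "t < u"
  proof (rule ccontr)
    assume "\<not> t < u"
    then show False using count_mono[of u t e] assms * by (simp add: dropped_def)
  qed
qed

definition index_approx :: "nat \<Rightarrow> nat \<Rightarrow> nat \<Rightarrow> nat" where
  "index_approx a s u = (if a = 0 then tail s u
     else if count (a - 1) u \<le> count (a - 1) s then L (a - 1) u
     else tail (code (a - 1) s (LEAST t. count (a - 1) s < count (a - 1) (Suc t) \<or> u \<le> t)) u)"

lemma computable_index_approx: "computable (\<lambda>p. index_approx (fst p) (fst (snd p)) (snd (snd p)))"
  unfolding index_approx_def code_def
  by (intro computable_intros computable_comp2[OF computable_L] computable_comp2[OF computable_tail]
      computable_comp2[OF computable_count]) auto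

lemma limit_index_approx_0: "dyadic_limit (index_approx 0 n) (tail_val n)"
  using limit_tail[of n] by (simp add: index_approx_def[abs_def])

lemma limit_index_approx_kept: "\<forall>t. count e t \<le> count e s \<Longrightarrow> dyadic_limit (index_approx (Suc e) s) (\<beta> e)"
  using limit_L[of e] by (simp add: index_approx_def[abs_def])

lemma limit_index_approx_dropped:
  assumes "dropped e s t"
  shows "dyadic_limit (index_approx (Suc e) s) (tail_val (code e s t))"
proof -
  let ?n = "code e s t"
  have "index_approx (Suc e) s = (\<lambda>u. if u \<le> t then L e u else tail ?n u)"
  proof
    fix u
    show "index_approx (Suc e) s u = (if u \<le> t then L e u else tail ?n u)"
    proof (cases "u \<le> t")
      case True
      then show ?thesis using dropped_less_iff[OF assms, of u] by (simp add: index_approx_def not_less)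
    next
      case False
      then have less: "count e s < count e u" using dropped_less_iff[OF assms, of u] by simp
      then show ?thesis
        using False dropped_unique[OF dropped_of_less(1)[OF less] assms] by (simp add: index_approx_def)
    qed
  qed
  \<comment> \<open>As the code is at least t, the tail at stage t + 1 is at least
    \<open>2 ^ Suc t - 2\<close>, while \<open>\<beta> e < 1\<close> keeps \<open>L e t\<close> at
    most \<open>2 ^ t - 1\<close>. So the switch does not decrease the approximation.\<close>
  moreover have "2 * L e t \<le> tail ?n (Suc t)"
  proof -
    have "Suc t - ?n \<le> 1" using le_code[of t e s] by simp
    then have "(2::nat) ^ (Suc t - ?n) \<le> 2 ^ 1" by (rule power_increasing) simp
    moreover have "L e t < 2 ^ t" using dyadic_limit_less_pow[OF limit_L less_1] .
    ultimately show ?thesis using tail_ge[of "Suc t" ?n] by simp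
  qed
  ultimately show ?thesis
    using dyadic_limit_switch[OF limit_L[of e] limit_tail[of ?n], of t] by simp
qed

definition valid :: "nat \<Rightarrow> nat \<Rightarrow> bool" where
  "valid a s \<longleftrightarrow> (if a = 0 then \<not> used s else appointed (a - 1) s)"

lemma computable_valid: "computable (\<lambda>p. valid (fst p) (snd p))"
  unfolding valid_def used_def appointed_def dropped_def Let_def
  by (intro computable_intros computable_comp2[OF computable_count])

lemma kept_or_dropped: "(\<forall>t. count e t \<le> count e s) \<or> (\<exists>t. dropped e s t)"
  using dropped_of_less(1) by (meson not_le)

lemma ex_limit_index_approx: "\<exists>z. dyadic_limit (index_approx a s) z"
  using kept_or_dropped limit_index_approx_0 limit_index_approx_kept limit_index_approx_dropped by (metis not0_implies_Suc)

definition index_val :: "nat \<Rightarrow> nat \<Rightarrow> real" where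
  "index_val a s = (SOME z. dyadic_limit (index_approx a s) z)"

lemma limit_index_val: "dyadic_limit (index_approx a s) (index_val a s)"
  unfolding index_val_def by (rule someI_ex[OF ex_limit_index_approx])

lemma index_val_eqI: "dyadic_limit (index_approx a s) z \<Longrightarrow> index_val a s = z"
  using limit_index_val[of a s] LIMSEQ_unique dyadic_limitD(3) by blast

section \<open>Every value has exactly one valid index\<close>

lemma index_val_cases:
  assumes "valid a s"
  obtains (unused) "a = 0" "\<not> used s" "index_val a s = tail_val s"
  | (kept) e where "a = Suc e" "appointed e s" "\<forall>t. count e t \<le> count e s" "index_val a s = \<beta> e"
  | (dropped) e t where "a = Suc e" "appointed e s" "dropped e s t" "index_val a s = tail_val (code e s t)"
proof (cases a)
  case 0
  then show ?thesis using assms unused index_val_eqI[OF limit_index_approx_0] by (simp add: valid_def)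
next
  case (Suc e)
  then have "appointed e s" using assms by (simp add: valid_def)
  then show ?thesis
    using kept_or_dropped[of e s] kept[OF Suc] dropped[OF Suc]
      index_val_eqI[OF limit_index_approx_kept[of e s]] index_val_eqI[OF limit_index_approx_dropped[of e s]] Suc by blast
qed

text \<open>An appointment marks the first stage at which the count has its current value; two
  followers that are kept share the final count.\<close>

lemma appointed_unique:
  assumes "appointed e s" "appointed e s'"
    and "\<forall>t. count e t \<le> count e s" "\<forall>t. count e t \<le> count e s'"
  shows "s = s'"
proof -
  have eq: "count e s = count e s'" using assms(3,4) by (meson antisym)
  have "\<not> r < r'" if "appointed e r'" "count e r = count e r'" for r r'
  proof
    assume "r < r'"
    then have "count e r \<le> count e (r' - 1)" by (intro count_mono) simp
    then show False using that \<open>r < r'\<close> by (auto simp: appointed_def)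
  qed
  then show ?thesis using assms(1,2) eq by (metis linorder_neqE_nat)
qed

text \<open>Kept values come from stable indices, which avoid all tails and the reals of smaller
  indices. Dropped followers are told apart by their codes, and a tail reached by one of them is
  \<open>used\<close>, so it has no index of its own.\<close>

lemma index_val_inject:
  assumes "valid a s" "valid a' s'" "index_val a s = index_val a' s'"
  shows "a = a' \<and> s = s'"
  using assms(1)
proof (cases rule: index_val_cases)
  case unused
  from assms(2) show ?thesis
  proof (cases rule: index_val_cases)
    case unused
    then show ?thesis using \<open>a = 0\<close> \<open>index_val a s = tail_val s\<close> assms(3) by (simp add: inj_tail_val)
  next
    case (kept e)
    then have "stable e" by (auto simp: stable_def)
    then show ?thesis using stable_distinct(2) \<open>index_val a s = tail_val s\<close> assms(3) kept by metis
  next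
    case (dropped e t)
    then have "s = code e s' t" using \<open>index_val a s = tail_val s\<close> assms(3) by (simp add: inj_tail_val)
    then show ?thesis using \<open>\<not> used s\<close> dropped used_iff by blast
  qed
next
  case (kept e)
  note kept1 = kept
  have st: "stable e" using kept by (auto simp: stable_def)
  from assms(2) show ?thesis
  proof (cases rule: index_val_cases)
    case unused
    then show ?thesis using stable_distinct(2)[OF st] kept1 assms(3) by metis
  next
    case (kept e')
    then have "stable e'" by (auto simp: stable_def)
    then have "e = e'"
      using stable_distinct(1)[OF st, of e'] stable_distinct(1)[of e' e] kept1 kept assms(3)
      by (metis linorder_neqE_nat)
    then show ?thesis using kept1 kept appointed_unique by blast
  next
    case (dropped e' t)
    then show ?thesis using stable_distinct(2)[OF st] kept1 assms(3) by metis
  qed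
next
  case (dropped e t)
  note dropped1 = dropped
  from assms(2) show ?thesis
  proof (cases rule: index_val_cases)
    case unused
    then have "s' = code e s t" using dropped1 assms(3) by (simp add: inj_tail_val)
    then show ?thesis using unused dropped1 used_iff by blast
  next
    case (kept e')
    then have "stable e'" by (auto simp: stable_def)
    then show ?thesis using stable_distinct(2) dropped1 assms(3) kept by metis
  next
    case (dropped e' t')
    then show ?thesis using dropped1 assms(3) by (simp add: inj_tail_val code_inject)
  qed
qed

lemma index_val_range: "{index_val a s | a s. valid a s} = range \<beta> \<union> range tail_val"
proof (intro equalityI subsetI)
  fix z assume "z \<in> {index_val a s | a s. valid a s}"
  then obtain a s where "valid a s" "z = index_val a s" by blast
  then show "z \<in> range \<beta> \<union> range tail_val" by (cases rule: index_val_cases) auto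
next
  fix z assume z: "z \<in> range \<beta> \<union> range tail_val"
  show "z \<in> {index_val a s | a s. valid a s}"
  proof (cases "z \<in> range tail_val")
    case True
    then obtain n where n: "z = tail_val n" by blast
    show ?thesis
    proof (cases "used n")
      case True
      then obtain e s t where "n = code e s t" "appointed e s" "dropped e s t"
        unfolding used_iff by blast
      then have "valid (Suc e) s" "z = index_val (Suc e) s"
        using n index_val_eqI[OF limit_index_approx_dropped] by (auto simp: valid_def)
      then show ?thesis by blast
    next
      case False
      then have "valid 0 n" "z = index_val 0 n" using n index_val_eqI[OF limit_index_approx_0] by (auto simp: valid_def)
      then show ?thesis by blast
    qed
  next
    case False
    then obtain i where "\<beta> i = z" using z by blast
    define e where "e = (LEAST e. \<beta> e = z)"
    have e: "\<beta> e = z" unfolding e_def by (rule LeastI) fact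
    have "stable e"
    proof (rule stableI)
      show "\<beta> i \<noteq> \<beta> e" if "i < e" for i
        using not_less_Least[of i "\<lambda>e. \<beta> e = z"] that e by (simp add: e_def)
      show "\<beta> e \<noteq> tail_val n" for n using False e by auto
    qed
    then obtain r where r: "\<forall>t. count e t \<le> count e r" unfolding stable_def by blast
    define s where "s = (LEAST s. count e s = count e r)"
    have s: "count e s = count e r" unfolding s_def by (rule LeastI[of _ r]) simp
    have "appointed e s"
    proof (cases s)
      case (Suc s')
      then have "count e s' \<noteq> count e r"
        using not_less_Least[of s' "\<lambda>s. count e s = count e r"] by (simp add: s_def)
      then have "count e s' < count e r" using r by (simp add: order_le_neq_trans)
      then show ?thesis using Suc s by (simp add: appointed_def)
    qed (simp add: appointed_def)
    then have "valid (Suc e) s" by (simp add: valid_def)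
    moreover have "z = index_val (Suc e) s" using index_val_eqI[OF limit_index_approx_kept] r s e by simp
    ultimately show ?thesis by blast
  qed
qed

text \<open>The valid pairs form an infinite decidable set, so listing them in increasing order
  turns them into indices without repetition.\<close>

lemma Friedberg_numbering:
  "\<exists>\<gamma>. left_re_numbering_of \<gamma> (range \<beta> \<union> range tail_val) \<and> Friedberg \<gamma>"
proof -
  define V where "V y \<longleftrightarrow> valid (fst (prod_decode y)) (snd (prod_decode y))" for y
  define v where "v y = index_val (fst (prod_decode y)) (snd (prod_decode y))" for y
  have V: "V (prod_encode (a, s)) \<longleftrightarrow> valid a s" "v (prod_encode (a, s)) = index_val a s" for a s
    by (simp_all add: V_def v_def)
  have inf: "infinite {y. V y}"
  proof -
    \<comment> \<open>Stage 0 appoints a follower for every e, which supplies infinitely many valid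
      pairs.\<close>
    have "inj (\<lambda>e. prod_encode (Suc e, 0))" by (rule injI) simp
    then have "infinite (range (\<lambda>e. prod_encode (Suc e, 0)))" by (rule range_inj_infinite)
    moreover have "range (\<lambda>e. prod_encode (Suc e, 0)) \<subseteq> {y. V y}"
      by (auto simp: V valid_def appointed_def)
    ultimately show ?thesis by (rule infinite_super[rotated])
  qed
  have inj: "inj_on v {y. V y}"
  proof (rule inj_onI)
    fix y y' assume "y \<in> {y. V y}" "y' \<in> {y. V y}" "v y = v y'"
    then show "y = y'"
      using index_val_inject unfolding V_def v_def mem_Collect_eq by (metis prod.expand prod_decode_eq)
  qed
  have image: "v ` {y. V y} = range \<beta> \<union> range tail_val"
    unfolding index_val_range[symmetric] v_def V_def
    by (auto simp: image_iff) (metis V fst_conv prod_encode_inverse snd_conv)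
  let ?f = "enumerate {y. V y}"
  have "computable (\<lambda>y. y \<in> {y. V y})"
    unfolding V_def mem_Collect_eq by (intro computable_intros computable_comp2[OF computable_valid])
  then have f: "computable ?f" using inf by (rule computable_enumerate)
  have "computable (\<lambda>p. index_approx (fst (prod_decode (?f (fst p)))) (snd (prod_decode (?f (fst p)))) (snd p))"
    by (intro computable_comp3[OF computable_index_approx] computable_intros computable_comp[OF f])
  then have "dyadic_approx (\<lambda>n. index_approx (fst (prod_decode (?f n))) (snd (prod_decode (?f n)))) (\<lambda>n. v (?f n))"
    by (simp add: dyadic_approx_def v_def limit_index_val)
  then have "left_re_numbering (\<lambda>n. v (?f n))" by (rule numbering_of_dyadic_approx)
  moreover have bij: "bij_betw ?f UNIV {y. V y}" using inf by (rule bij_enumerate)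
  then have "range (\<lambda>n. v (?f n)) = range \<beta> \<union> range tail_val"
    unfolding image[symmetric] by (metis bij_betw_imp_surj_on image_image)
  moreover have "Friedberg (\<lambda>n. v (?f n))"
  proof -
    have "inj (v \<circ> ?f)"
      using bij inj by (intro comp_inj_on) (auto simp: bij_betw_def)
    then show ?thesis unfolding Friedberg_def by (auto simp: inj_def)
  qed
  ultimately show ?thesis unfolding left_re_numbering_of_def by blast
qed

end

lemma Friedberg_of_numbering:
  assumes C: "\<forall>X\<in>C. infinite_real X" and X: "shift_persistent C X"
    and \<beta>: "left_re_numbering_of \<beta> C"
  shows "\<exists>\<gamma>. left_re_numbering_of \<gamma> C \<and> Friedberg \<gamma>"
proof -
  have range: "range \<beta> = C" using \<beta> by (simp add: left_re_numbering_of_def)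
  obtain L where L: "dyadic_approx L \<beta>"
    using \<beta> dyadic_approx_of_numbering unfolding left_re_numbering_of_def by blast
  have "X \<in> range \<beta>" using X range by (simp add: shift_persistent_def)
  then obtain i where i: "X = \<beta> i" by blast
  have less: "\<beta> e < 1" for e using C range infinite_real_bounds(2) by blast
  have cL: "computable (\<lambda>p. L (fst p) (snd p))" using L by (simp add: dyadic_approx_def)
  interpret Friedberg_construction \<beta> L "L i" X
  proof
    show "dyadic_approx L \<beta>" by (rule L)
    show "\<beta> e < 1" for e by (rule less)
    show "dyadic_limit (L i) X" using L i by (simp add: dyadic_approx_def)
    show "X < 1" using less i by simp
    show "computable (L i)" by (intro computable_comp2[OF cL] computable_intros)
  qed
  have "tail_val n \<in> C" for n
  proof -
    \<comment> \<open>The string of n ones is \<open>2 ^ n - 1\<close> written with n digits, so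
      every tail is a shift of X and adds nothing outside C.\<close>
    have "tail_val n = (real (2 ^ n - 1) + X) / 2 ^ n"
      by (simp add: tail_val_def of_nat_diff field_simps)
    then show ?thesis using shift_persistent_dyadic_shift[OF X, of "2 ^ n - 1" n] by simp
  qed
  then have "range \<beta> \<union> range tail_val = C" using range by auto
  then show ?thesis using Friedberg_numbering by simp
qed

theorem theorem3p5:
  fixes C :: "real set" and \<alpha> :: "nat \<Rightarrow> real"
  assumes "\<forall>X \<in> C. left_re X \<and> infinite_real X"
    and "\<exists>X. shift_persistent C X"
    and "universal_left_re_numbering \<alpha>"
  shows "(Sigma3_set {e. \<alpha> e \<in> C} \<longleftrightarrow> (\<exists>\<beta>. left_re_numbering_of \<beta> C)) \<and>
         ((\<exists>\<beta>. left_re_numbering_of \<beta> C) \<longleftrightarrow> (\<exists>\<beta>. left_re_numbering_of \<beta> C \<and> Friedberg \<beta>))"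
proof -
  obtain X where X: "shift_persistent C X" using assms(2) by blast
  have "left_re_numbering \<alpha>"
    using assms(3) by (simp add: universal_left_re_numbering_def left_re_numbering_of_def)
  then show ?thesis
    using Sigma3_of_numbering numbering_of_Sigma3[OF assms(1) X assms(3)]
      Friedberg_of_numbering[OF _ X] assms(1) by blast
qed

end
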